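(* Let $0<r<1$. Then the closed unit disk $\overline{\mathbb{D}}$ is a minimal spectral set for the class $C_\alpha$.
   Context: All operators are bounded linear maps on complex Hilbert spaces. $C_\alpha$ is the class of invertible operators $T$ with $-T^{*2}T^2+(1+r^2)T^*T-r^2I\ge0$. For compact $X\subset\mathbb{C}$, $Rat(X)$ is the algebra of rational functions with poles off $X$; $X$ is a spectral set for an operator $T$ if $\sigma(T)\subseteq X$ and $\|f(T)\|\le\sup_{\xi\in X}|f(\xi)|$ for all $f\in Rat(X)$. A compact set $X$ is a minimal spectral set for a class $\mathcal{T}$ of operators if $X$ is a spectral set for every member of $\mathcal{T}$ and for every proper compact subset $X'$ of $X$ there is $T\in\mathcal{T}$ such that $X'$ is not a spectral set for $T$. *)

theory Defs
  imports "HOL-Analysis.Analysis" "HOL-Computational_Algebra.Polynomial"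
begin

text \<open>
  Complex Hilbert spaces, the inner product being linear in its first argument. The unit law and
  positive definiteness follow from compatibility with the real scalar multiplication and the norm.
\<close>

class complex_hilbert = banach +
  fixes scaleC :: "complex \<Rightarrow> 'a \<Rightarrow> 'a" (infixr "*\<^sub>C" 75)
    and cinner :: "'a \<Rightarrow> 'a \<Rightarrow> complex"
  assumes scaleC_add_right: "c *\<^sub>C (x + y) = c *\<^sub>C x + c *\<^sub>C y"
    and scaleC_add_left: "(c + d) *\<^sub>C x = c *\<^sub>C x + d *\<^sub>C x"
    and scaleC_scaleC: "c *\<^sub>C d *\<^sub>C x = (c * d) *\<^sub>C x"
    and scaleR_scaleC: "t *\<^sub>R x = complex_of_real t *\<^sub>C x"
    and cinner_commute: "cinner x y = cnj (cinner y x)"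
    and cinner_add_left: "cinner (x + y) z = cinner x z + cinner y z"
    and cinner_scaleC_left: "cinner (c *\<^sub>C x) y = c * cinner x y"
    and cinner_self: "cinner x x = complex_of_real ((norm x)\<^sup>2)"

text \<open>
  A class of operators acting on possibly different Hilbert spaces is a set of pairs \<open>(M, T)\<close>: the
  space \<open>M\<close> is a closed complex subspace of an ambient Hilbert space, which plays the role of a
  universe, and \<open>T\<close> is an operator on \<open>M\<close>. All notions below are relative to \<open>M\<close> and do not
  depend on the values of \<open>T\<close> outside \<open>M\<close>.
\<close>

definition closed_csubspace :: "'a::complex_hilbert set \<Rightarrow> bool" where
  "closed_csubspace M \<longleftrightarrow> closed M \<and> subspace M \<and> (\<forall>c. \<forall>x\<in>M. c *\<^sub>C x \<in> M)"

definition bounded_op :: "'a::complex_hilbert set \<Rightarrow> ('a \<Rightarrow> 'a) \<Rightarrow> bool" where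
  "bounded_op M T \<longleftrightarrow>
     (\<forall>x\<in>M. T x \<in> M) \<and>
     (\<forall>x\<in>M. \<forall>y\<in>M. T (x + y) = T x + T y) \<and>
     (\<forall>c. \<forall>x\<in>M. T (c *\<^sub>C x) = c *\<^sub>C T x) \<and>
     (\<exists>K. \<forall>x\<in>M. norm (T x) \<le> K * norm x)"

definition op_norm :: "'a::complex_hilbert set \<Rightarrow> ('a \<Rightarrow> 'a) \<Rightarrow> real" where
  "op_norm M T = (SUP x\<in>{x \<in> M. norm x \<le> 1}. norm (T x))"

definition invertible_op :: "'a::complex_hilbert set \<Rightarrow> ('a \<Rightarrow> 'a) \<Rightarrow> bool" where
  "invertible_op M T \<longleftrightarrow>
     bounded_op M T \<and> (\<exists>S. bounded_op M S \<and> (\<forall>x\<in>M. S (T x) = x \<and> T (S x) = x))"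

definition spectrum_op :: "'a::complex_hilbert set \<Rightarrow> ('a \<Rightarrow> 'a) \<Rightarrow> complex set" where
  "spectrum_op M T = {z. \<not> invertible_op M (\<lambda>x. z *\<^sub>C x - T x)}"

text \<open>For a bounded operator on a Hilbert space \<open>M\<close> the adjoint exists and is unique on \<open>M\<close>.\<close>

definition adjoint_op :: "'a::complex_hilbert set \<Rightarrow> ('a \<Rightarrow> 'a) \<Rightarrow> 'a \<Rightarrow> 'a" where
  "adjoint_op M T =
     (SOME S. bounded_op M S \<and> (\<forall>x\<in>M. \<forall>y\<in>M. cinner (S x) y = cinner x (T y)))"

definition positive_op :: "'a::complex_hilbert set \<Rightarrow> ('a \<Rightarrow> 'a) \<Rightarrow> bool" where
  "positive_op M A \<longleftrightarrow> (\<forall>x\<in>M. cinner (A x) x \<in> \<real> \<and> 0 \<le> Re (cinner (A x) x))"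

definition C_alpha :: "real \<Rightarrow> ('a::complex_hilbert set \<times> ('a \<Rightarrow> 'a)) set" where
  "C_alpha r = {(M, T). closed_csubspace M \<and> invertible_op M T \<and>
     positive_op M (\<lambda>x. - (adjoint_op M T ^^ 2) ((T ^^ 2) x)
                        + (1 + r\<^sup>2) *\<^sub>R adjoint_op M T (T x) - r\<^sup>2 *\<^sub>R x)}"

definition poly_op :: "complex poly \<Rightarrow> ('a::complex_hilbert \<Rightarrow> 'a) \<Rightarrow> 'a \<Rightarrow> 'a" where
  "poly_op p T x = (\<Sum>i\<le>degree p. coeff p i *\<^sub>C (T ^^ i) x)"

text \<open>\<open>f(T) = p(T) q(T)\<^sup>-\<^sup>1\<close> for \<open>f = p/q\<close>; meaningful when \<open>q\<close> has no zero in the spectrum of \<open>T\<close>.\<close>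

definition rat_op ::
  "'a::complex_hilbert set \<Rightarrow> complex poly \<Rightarrow> complex poly \<Rightarrow> ('a \<Rightarrow> 'a) \<Rightarrow> 'a \<Rightarrow> 'a" where
  "rat_op M p q T x = poly_op p T (inv_into M (poly_op q T) x)"

text \<open>
  The algebra \<open>Rat(X)\<close> consists of the quotients \<open>p/q\<close> with \<open>q\<close> without zeros in \<open>X\<close>; the condition
  \<open>q \<noteq> 0\<close> matters only for empty \<open>X\<close>. The supremum is the usual one for compact nonempty \<open>X\<close>; for
  empty \<open>X\<close> it is taken in the nonnegative reals, hence the inserted \<open>0\<close>.
\<close>

definition Rat :: "complex set \<Rightarrow> (complex poly \<times> complex poly) set" where
  "Rat X = {(p, q). q \<noteq> 0 \<and> (\<forall>z\<in>X. poly q z \<noteq> 0)}"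

definition spectral_set ::
  "complex set \<Rightarrow> 'a::complex_hilbert set \<Rightarrow> ('a \<Rightarrow> 'a) \<Rightarrow> bool" where
  "spectral_set X M T \<longleftrightarrow>
     spectrum_op M T \<subseteq> X \<and>
     (\<forall>(p, q)\<in>Rat X. op_norm M (rat_op M p q T)
        \<le> Sup (insert 0 ((\<lambda>z. cmod (poly p z / poly q z)) ` X)))"

definition minimal_spectral_set ::
  "complex set \<Rightarrow> ('a::complex_hilbert set \<times> ('a \<Rightarrow> 'a)) set \<Rightarrow> bool" where
  "minimal_spectral_set X \<T> \<longleftrightarrow>
     compact X \<and>
     (\<forall>(M, T)\<in>\<T>. spectral_set X M T) \<and>
     (\<forall>X'. compact X' \<and> X' \<subset> X \<longrightarrow> (\<exists>(M, T)\<in>\<T>. \<not> spectral_set X' M T))"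

end

theory Submission
  imports
    Defs
    "HOL-Computational_Algebra.Fundamental_Theorem_Algebra"
    "HOL-Library.Nat_Bijection"
begin

text \<open>
  For \<open>T\<close> in the class, the numbers \<open>\<parallel>T\<^sup>-\<^sup>k u\<parallel>\<^sup>2 - \<parallel>T\<^sup>-\<^sup>k\<^sup>-\<^sup>1 u\<parallel>\<^sup>2\<close> would be nondecreasing in \<open>k\<close> if the first of
  them were positive, and \<open>\<parallel>T\<^sup>-\<^sup>k u\<parallel>\<^sup>2\<close> would tend to minus infinity; hence \<open>T\<close> is a contraction and von
  Neumann's inequality applies. For minimality, a proper compact subset \<open>X\<close> of the disk misses a ball
  around some \<open>a\<close> with \<open>0 < \<bar>a\<bar> < 1\<close>. For large \<open>N\<close> the function \<open>f(z) = z\<^sup>N (1 - cnj a z) / (z - a)\<close>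
  is bounded by \<open>1\<close> on \<open>X\<close>. It is unimodular on the unit circle but has nonzero Laurent coefficients of
  negative index, and this forces \<open>\<parallel>f(T)\<parallel> > 1\<close> for the bilateral shift with weights \<open>1\<close> (left) and \<open>r\<close>
  (right), which belongs to the class.
\<close>

section \<open>Complex Hilbert spaces\<close>

text \<open>Every point of the annulus r < |z| < 1 is an eigenvalue of the shift, so a hole of
  \<open>X\<close> there already contradicts the spectral inclusion. A hole in |z| < r is not seen
  by the spectrum and needs a norm estimate; the one used here treats all holes alike, with the same
  operator for every \<open>X\<close>. Why the negative indices matter: since f is unimodular on the
  circle, the squared moduli of its Laurent coefficients sum to 1, and for weights all equal to 1
  this sum is the squared norm of the adjoint of f(T) at a basis vector. At the basis vector where
  the weights change, the coefficient of index -m is amplified by r^(-m), so the sum exceeds 1. For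
  a = 0 there is no negative index, for |a| = 1 no pole inside the circle, which explains the
  restriction on \<open>a\<close>. Von Neumann's inequality is derived by finite Fourier transforms
  of orbits and reaches quotients by approximating 1/q with polynomials. The shift needs infinitely
  many orthonormal vectors, whence the assumption on the universe.\<close>

lemma scaleC_one [simp]: "1 *\<^sub>C (x::'a::complex_hilbert) = x"
  using scaleR_scaleC[of 1 x] by simp

lemma scaleC_zero_right [simp]: "c *\<^sub>C (0::'a::complex_hilbert) = 0"
  using scaleC_add_right[of c 0 "0::'a"] by simp

lemma scaleC_zero_left [simp]: "0 *\<^sub>C (x::'a::complex_hilbert) = 0"
  using scaleC_add_left[of 0 0 x] by simp

lemma scaleC_minus_right [simp]: "c *\<^sub>C (- x) = - (c *\<^sub>C (x::'a::complex_hilbert))"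
  using scaleC_add_right[of c x "-x"] by (simp add: eq_neg_iff_add_eq_0 add.commute)

lemma scaleC_minus_left [simp]: "(- c) *\<^sub>C x = - (c *\<^sub>C (x::'a::complex_hilbert))"
  using scaleC_add_left[of c "-c" x] by (simp add: eq_neg_iff_add_eq_0 add.commute)

lemma scaleC_diff_right: "c *\<^sub>C (x - y) = c *\<^sub>C x - c *\<^sub>C (y::'a::complex_hilbert)"
  using scaleC_add_right[of c x "-y"] by simp

lemma scaleC_sum_right: "c *\<^sub>C (\<Sum>i\<in>A. f i) = (\<Sum>i\<in>A. c *\<^sub>C (f i :: 'a::complex_hilbert))"
  by (induction A rule: infinite_finite_induct) (auto simp: scaleC_add_right)

lemma scaleC_sum_left: "(\<Sum>i\<in>A. f i) *\<^sub>C x = (\<Sum>i\<in>A. f i *\<^sub>C (x :: 'a::complex_hilbert))"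
  by (induction A rule: infinite_finite_induct) (auto simp: scaleC_add_left)

lemma cinner_zero_left [simp]: "cinner (0::'a::complex_hilbert) y = 0"
  using cinner_add_left[of 0 "0::'a" y] by simp

lemma cinner_minus_left [simp]: "cinner (- x) (y::'a::complex_hilbert) = - cinner x y"
  using cinner_add_left[of x "-x" y] by (simp add: eq_neg_iff_add_eq_0 add.commute)

lemma cinner_diff_left: "cinner (x - y) (z::'a::complex_hilbert) = cinner x z - cinner y z"
  using cinner_add_left[of x "-y" z] by simp

lemma cinner_scaleR_left: "cinner (t *\<^sub>R x) (y::'a::complex_hilbert) = of_real t * cinner x y"
  by (simp add: scaleR_scaleC cinner_scaleC_left)

lemma cinner_add_right: "cinner x (y + z) = cinner x y + cinner x (z::'a::complex_hilbert)"
  by (metis cinner_add_left cinner_commute complex_cnj_add)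

lemma cinner_scaleC_right: "cinner x (c *\<^sub>C y) = cnj c * cinner x (y::'a::complex_hilbert)"
  by (metis cinner_scaleC_left cinner_commute complex_cnj_mult)

lemma cinner_zero_right [simp]: "cinner x (0::'a::complex_hilbert) = 0"
  using cinner_add_right[of x 0 "0::'a"] by simp

lemma cinner_minus_right [simp]: "cinner x (- y::'a::complex_hilbert) = - cinner x y"
  using cinner_add_right[of x y "-y"] by (simp add: eq_neg_iff_add_eq_0 add.commute)

lemma cinner_sum_left: "cinner (\<Sum>i\<in>A. f i) (y::'a::complex_hilbert) = (\<Sum>i\<in>A. cinner (f i) y)"
  by (induction A rule: infinite_finite_induct) (auto simp: cinner_add_left)

lemma cinner_sum_right: "cinner (x::'a::complex_hilbert) (\<Sum>i\<in>A. f i) = (\<Sum>i\<in>A. cinner x (f i))"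
  by (induction A rule: infinite_finite_induct) (auto simp: cinner_add_right)

lemma norm_scaleC [simp]: "norm (c *\<^sub>C (x::'a::complex_hilbert)) = cmod c * norm x"
proof -
  have "complex_of_real ((norm (c *\<^sub>C x))\<^sup>2) = c * cnj c * complex_of_real ((norm x)\<^sup>2)"
    by (simp only: cinner_self[symmetric] cinner_scaleC_left cinner_scaleC_right mult.assoc mult.left_commute)
  also have "\<dots> = complex_of_real ((cmod c * norm x)\<^sup>2)"
    by (simp only: complex_norm_square[symmetric] of_real_mult[symmetric] power_mult_distrib)
  finally show ?thesis
    by (metis norm_ge_zero of_real_eq_iff power2_eq_iff_nonneg mult_nonneg_nonneg)
qed

lemma norm_add_sq:
  "(norm (x + y::'a::complex_hilbert))\<^sup>2 = (norm x)\<^sup>2 + (norm y)\<^sup>2 + 2 * Re (cinner x y)"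
proof -
  have "complex_of_real ((norm (x + y))\<^sup>2) =
      complex_of_real ((norm x)\<^sup>2) + complex_of_real ((norm y)\<^sup>2) + (cinner x y + cnj (cinner x y))"
    unfolding cinner_self[symmetric] cinner_commute[of x y, symmetric]
    by (simp add: cinner_add_left cinner_add_right cinner_commute[of y x])
  also have "cinner x y + cnj (cinner x y) = complex_of_real (2 * Re (cinner x y))"
    by (rule complex_add_cnj)
  finally show ?thesis
    by (simp only: of_real_add[symmetric] of_real_eq_iff)
qed

lemma norm_diff_sq:
  "(norm (x - y::'a::complex_hilbert))\<^sup>2 = (norm x)\<^sup>2 + (norm y)\<^sup>2 - 2 * Re (cinner x y)"
  using norm_add_sq[of x "-y"] by simp

lemma Cauchy_Schwarz_cinner: "cmod (cinner x y) \<le> norm x * norm (y::'a::complex_hilbert)"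
proof (cases "y = 0")
  case False
  then have ny: "(norm y)\<^sup>2 > 0" by simp
  define c where "c = cinner x y / complex_of_real ((norm y)\<^sup>2)"
  have "cinner x (c *\<^sub>C y) = complex_of_real ((cmod (cinner x y))\<^sup>2 / (norm y)\<^sup>2)"
    by (simp add: cinner_scaleC_right c_def complex_norm_square[symmetric] mult.commute)
  moreover have "(norm (c *\<^sub>C y))\<^sup>2 = (cmod (cinner x y))\<^sup>2 / (norm y)\<^sup>2"
    using ny by (simp add: c_def norm_divide power_mult_distrib power2_eq_square norm_mult)
  ultimately have "(norm (x - c *\<^sub>C y))\<^sup>2 = (norm x)\<^sup>2 - (cmod (cinner x y))\<^sup>2 / (norm y)\<^sup>2"
    unfolding norm_diff_sq by simp
  then have "(cmod (cinner x y))\<^sup>2 / (norm y)\<^sup>2 \<le> (norm x)\<^sup>2"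
    by (metis diff_ge_0_iff_ge zero_le_power2)
  then have "(cmod (cinner x y))\<^sup>2 \<le> (norm x * norm y)\<^sup>2"
    using ny by (simp add: divide_le_eq power_mult_distrib)
  then show ?thesis
    by (rule power2_le_imp_le) simp
qed simp

lemma bounded_linear_cinner_left: "bounded_linear (\<lambda>x::'a::complex_hilbert. cinner x y)"
proof (rule bounded_linear_intro[where K = "norm y"])
  show "norm (cinner x y) \<le> norm x * norm y" for x
    by (rule Cauchy_Schwarz_cinner)
qed (auto simp: cinner_add_left cinner_scaleR_left scaleR_conv_of_real)

lemma bounded_linear_scaleC: "bounded_linear (\<lambda>x::'a::complex_hilbert. c *\<^sub>C x)"
proof (rule bounded_linear_intro[where K = "cmod c"])
  show "c *\<^sub>C t *\<^sub>R x = t *\<^sub>R c *\<^sub>C x" for t and x :: 'a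
    by (simp add: scaleR_scaleC scaleC_scaleC mult.commute)
qed (auto simp: scaleC_add_right)

lemma closed_csubspaceD:
  assumes "closed_csubspace M"
  shows "closed M" "subspace M" "0 \<in> M" "x \<in> M \<Longrightarrow> y \<in> M \<Longrightarrow> x + y \<in> M"
    "x \<in> M \<Longrightarrow> y \<in> M \<Longrightarrow> x - y \<in> M" "x \<in> M \<Longrightarrow> c *\<^sub>C x \<in> M"
    "x \<in> M \<Longrightarrow> t *\<^sub>R x \<in> M" "(\<And>i. i \<in> I \<Longrightarrow> f i \<in> M) \<Longrightarrow> (\<Sum>i\<in>I. f i) \<in> M"
  using assms by (auto simp: closed_csubspace_def subspace_0 subspace_add subspace_diff
      subspace_scale subspace_sum)

text \<open>The representing vector minimises \<open>\<parallel>x\<parallel>\<^sup>2 - 2 Re \<phi>(x)\<close>; this avoids the projection theorem.\<close>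

lemma riesz_representation:
  fixes \<phi> :: "'a::complex_hilbert \<Rightarrow> complex"
  assumes M: "closed_csubspace M"
    and add: "\<And>x y. x \<in> M \<Longrightarrow> y \<in> M \<Longrightarrow> \<phi> (x + y) = \<phi> x + \<phi> y"
    and scale: "\<And>c x. x \<in> M \<Longrightarrow> \<phi> (c *\<^sub>C x) = c * \<phi> x"
    and bound: "\<And>x. x \<in> M \<Longrightarrow> cmod (\<phi> x) \<le> K * norm x"
  obtains z where "z \<in> M" "\<And>x. x \<in> M \<Longrightarrow> \<phi> x = cinner x z"
proof -
  note MD = closed_csubspaceD[OF M]
  define J where "J x = (norm x)\<^sup>2 - 2 * Re (\<phi> x)" for x
  have scaleR: "\<phi> (t *\<^sub>R x) = of_real t * \<phi> x" if "x \<in> M" for t x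
    using scale[OF that] by (simp add: scaleR_scaleC)
  have diff: "\<phi> (x - y) = \<phi> x - \<phi> y" if "x \<in> M" "y \<in> M" for x y
    using add[of x "(-1) *\<^sub>C y"] scale[of y "-1"] that MD(6)[of y "-1"] by simp
  have Jlow: "J x \<ge> - K\<^sup>2" if "x \<in> M" for x
  proof -
    have "Re (\<phi> x) \<le> K * norm x"
      using bound[OF that] complex_Re_le_cmod[of "\<phi> x"] by linarith
    then show ?thesis
      using zero_le_power2[of "norm x - K"] by (simp add: J_def power2_diff mult.commute)
  qed
  have bdd: "bdd_below (J ` M)"
    using Jlow by (auto intro!: bdd_belowI)
  have ne: "J ` M \<noteq> {}" using MD(3) by auto
  define I where "I = Inf (J ` M)"
  have I_le: "I \<le> J x" if "x \<in> M" for x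
    unfolding I_def using bdd that by (auto intro: cInf_lower)
  \<comment> \<open>The linear part of \<open>J\<close> cancels in this combination, so the
    parallelogram law survives; as \<open>J\<close> is at least \<open>I\<close> at the midpoint,
    near-minimisers must be close together.\<close>
  have para: "(norm (x - y))\<^sup>2 = 2 * J x + 2 * J y - 4 * J ((1/2) *\<^sub>R (x + y))"
    if "x \<in> M" "y \<in> M" for x y
  proof -
    have "(norm ((1/2) *\<^sub>R (x + y)))\<^sup>2 = (norm (x + y))\<^sup>2 / 4"
      by (simp add: power2_eq_square)
    moreover have "Re (\<phi> ((1/2) *\<^sub>R (x + y))) = (Re (\<phi> x) + Re (\<phi> y)) / 2"
      using that MD(4) by (simp add: scaleR add)
    ultimately show ?thesis
      unfolding J_def by (simp add: norm_add_sq norm_diff_sq algebra_simps)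
  qed
  have "\<exists>x\<in>M. J x < I + 1 / real (Suc n)" for n
    using cInf_lessD[OF ne, of "I + 1 / real (Suc n)"] by (auto simp: I_def)
  then obtain s where sM: "\<And>n. s n \<in> M" and sJ: "\<And>n. J (s n) < I + 1 / real (Suc n)"
    by metis
  have dist_s: "(norm (s m - s n))\<^sup>2 \<le> 2 / real (Suc m) + 2 / real (Suc n)" for m n
  proof -
    have "I \<le> J ((1/2) *\<^sub>R (s m + s n))"
      by (intro I_le MD sM)
    then show ?thesis
      using para[OF sM sM, of m n] sJ[of m] sJ[of n] by (simp add: algebra_simps)
  qed
  have "Cauchy s"
  proof (rule metric_CauchyI)
    fix e :: real assume e: "e > 0"
    obtain k :: nat where k: "4 / e\<^sup>2 < real k" using reals_Archimedean2 by blast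
    have k0: "real k > 0" using k e by (meson divide_pos_pos less_trans zero_less_numeral zero_less_power)
    have "dist (s m) (s n) < e" if "m \<ge> k" "n \<ge> k" for m n
    proof -
      have le: "2 / real (Suc i) \<le> 2 / real k" if "i \<ge> k" for i
        using that k0 by (intro divide_left_mono) auto
      have "(norm (s m - s n))\<^sup>2 \<le> 4 / real k"
        using dist_s[of m n] le[OF that(1)] le[OF that(2)] by simp
      also have "\<dots> < e\<^sup>2" using k k0 e by (simp add: field_simps)
      finally show ?thesis using e by (simp add: dist_norm power2_less_imp_less)
    qed
    then show "\<exists>k. \<forall>m\<ge>k. \<forall>n\<ge>k. dist (s m) (s n) < e" by blast
  qed
  then obtain z where z: "s \<longlonglongrightarrow> z"
    using Cauchy_convergent convergent_def by blast
  have zM: "z \<in> M" using closed_sequentially[OF MD(1) sM z] .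
  have "(\<lambda>n. \<phi> (s n)) \<longlonglongrightarrow> \<phi> z"
  proof (rule LIM_zero_cancel, rule Lim_null_comparison)
    show "\<forall>\<^sub>F n in sequentially. norm (\<phi> (s n) - \<phi> z) \<le> K * norm (s n - z)"
      using bound MD(5) sM zM diff by (intro always_eventually allI) metis
    show "(\<lambda>n. K * norm (s n - z)) \<longlonglongrightarrow> 0"
      by (rule tendsto_eq_intros | rule z | simp)+
  qed
  then have "(\<lambda>n. J (s n)) \<longlonglongrightarrow> J z"
    unfolding J_def by (intro tendsto_intros z)
  moreover have "(\<lambda>n. I + 1 / real (Suc n)) \<longlonglongrightarrow> I"
    using tendsto_add[OF tendsto_const[of I] LIMSEQ_inverse_real_of_nat]
    by (simp add: inverse_eq_divide)
  ultimately have "J z \<le> I"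
    using sJ by (intro LIMSEQ_le[of "\<lambda>n. J (s n)"]) (auto intro: less_imp_le)
  then have min: "J z \<le> J x" if "x \<in> M" for x
    using I_le[OF that] by linarith
  \<comment> \<open>First-order condition: \<open>J (t *\<^sub>R h + z)\<close> is smallest at t =
    0, so its linear coefficient \<open>2 * b\<close> in t must vanish.\<close>
  have Re_eq: "Re (\<phi> h) = Re (cinner h z)" if h: "h \<in> M" for h
  proof -
    define b where "b = Re (cinner h z) - Re (\<phi> h)"
    have ineq: "0 \<le> t\<^sup>2 * (norm h)\<^sup>2 + 2 * t * b" for t :: real
    proof -
      have "J z \<le> J (t *\<^sub>R h + z)" using h zM by (intro min MD)
      moreover have "(norm (t *\<^sub>R h + z))\<^sup>2 = t\<^sup>2 * (norm h)\<^sup>2 + (norm z)\<^sup>2 + 2 * (t * Re (cinner h z))"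
        by (simp add: norm_add_sq cinner_scaleR_left power_mult_distrib)
      moreover have "Re (\<phi> (t *\<^sub>R h + z)) = t * Re (\<phi> h) + Re (\<phi> z)"
        using h zM MD(7)[OF h, of t] by (simp add: add scaleR)
      ultimately show ?thesis
        by (simp add: J_def b_def algebra_simps)
    qed
    have "b = 0"
    proof (rule ccontr)
      assume b: "b \<noteq> 0"
      \<comment> \<open>Near the vertex of the quadratic; the added 1 keeps the denominator positive
        even for \<open>h = 0\<close>.\<close>
      define t where "t = - b / ((norm h)\<^sup>2 + 1)"
      have "((norm h)\<^sup>2 + 1) > 0" by (simp add: add_nonneg_pos)
      then have "t * ((norm h)\<^sup>2 + 1) = - b" by (simp add: t_def)
      then have "t * (t * ((norm h)\<^sup>2 + 1)) = - (t * b)" by simp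
      then have "t\<^sup>2 * (norm h)\<^sup>2 + 2 * t * b = - (t\<^sup>2) + t * b"
        by (simp add: algebra_simps power2_eq_square)
      also have "t * b = - (b\<^sup>2 / ((norm h)\<^sup>2 + 1))" by (simp add: t_def power2_eq_square)
      finally have eq: "t\<^sup>2 * (norm h)\<^sup>2 + 2 * t * b = - (t\<^sup>2) + - (b\<^sup>2 / ((norm h)\<^sup>2 + 1))" .
      have "b\<^sup>2 / ((norm h)\<^sup>2 + 1) > 0"
        using b \<open>(norm h)\<^sup>2 + 1 > 0\<close> by (intro divide_pos_pos) auto
      then show False
        using ineq[of t] zero_le_power2[of t] unfolding eq by linarith
    qed
    then show ?thesis by (simp add: b_def)
  qed
  have "\<phi> x = cinner x z" if x: "x \<in> M" for x
  proof (rule complex_eqI)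
    show "Re (\<phi> x) = Re (cinner x z)" by (rule Re_eq[OF x])
    show "Im (\<phi> x) = Im (cinner x z)"
      using Re_eq[OF MD(6)[OF x, of \<i>]] x by (simp add: scale cinner_scaleC_left)
  qed
  with zM show ?thesis by (rule that)
qed

section \<open>Operators on a closed subspace\<close>

lemma bounded_opD:
  assumes "bounded_op M T"
  shows "x \<in> M \<Longrightarrow> T x \<in> M" "x \<in> M \<Longrightarrow> y \<in> M \<Longrightarrow> T (x + y) = T x + T y"
    "x \<in> M \<Longrightarrow> T (c *\<^sub>C x) = c *\<^sub>C T x"
  using assms by (auto simp: bounded_op_def)

lemma bounded_op_diff:
  assumes "closed_csubspace M" "bounded_op M T" "x \<in> M" "y \<in> M"
  shows "T (x - y) = T x - T y"
  using bounded_opD(2)[OF assms(2), of x "(-1) *\<^sub>C y"] bounded_opD(3)[OF assms(2), of y "-1"]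
    closed_csubspaceD(6)[OF assms(1), of y "-1"] assms(3,4) by simp

lemma bounded_op_zero:
  assumes "closed_csubspace M" "bounded_op M T"
  shows "T 0 = 0"
  using bounded_op_diff[OF assms, of 0 0] closed_csubspaceD(3)[OF assms(1)] by simp

lemma bounded_op_sum:
  assumes "closed_csubspace M" "bounded_op M T" "\<And>i. i \<in> I \<Longrightarrow> f i \<in> M"
  shows "T (\<Sum>i\<in>I. f i) = (\<Sum>i\<in>I. T (f i))"
  using assms(3)
proof (induction I rule: infinite_finite_induct)
  case (insert i I)
  then show ?case
    by (simp add: bounded_opD(2)[OF assms(2)] closed_csubspaceD(8)[OF assms(1)])
qed (use bounded_op_zero[OF assms(1,2)] in auto)

lemma bounded_op_norm_bound:
  assumes "bounded_op M T"
  obtains K where "K \<ge> 0" "\<And>x. x \<in> M \<Longrightarrow> norm (T x) \<le> K * norm x"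
proof -
  obtain K where K: "\<And>x. x \<in> M \<Longrightarrow> norm (T x) \<le> K * norm x"
    using assms unfolding bounded_op_def by blast
  show ?thesis
  proof (rule that[of "\<bar>K\<bar>"])
    show "norm (T x) \<le> \<bar>K\<bar> * norm x" if "x \<in> M" for x
      using K[OF that] mult_right_mono[OF abs_ge_self[of K] norm_ge_zero[of x]] by linarith
  qed simp
qed

text \<open>The value at \<open>x\<close> is the Riesz vector of
  \<open>\<lambda>y. cinner (T y) x\<close>; uniqueness of such vectors inside \<open>M\<close>
  makes the choice linear. This entitles the \<open>SOME\<close> in \<open>adjoint_op\<close> to its
  defining property.\<close>

lemma adjoint_exists:
  assumes M: "closed_csubspace M" and T: "bounded_op M T"
  shows "\<exists>S. bounded_op M S \<and> (\<forall>x\<in>M. \<forall>y\<in>M. cinner (S x) y = cinner x (T y))"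
proof -
  note MD = closed_csubspaceD[OF M]
  obtain K where K0: "K \<ge> 0" and K: "\<And>x. x \<in> M \<Longrightarrow> norm (T x) \<le> K * norm x"
    using bounded_op_norm_bound[OF T] by blast
  have "\<exists>z\<in>M. \<forall>y\<in>M. cinner (T y) x = cinner y z" if x: "x \<in> M" for x
  proof (rule riesz_representation[OF M, of "\<lambda>y. cinner (T y) x" "K * norm x"])
    show "cmod (cinner (T y) x) \<le> K * norm x * norm y" if "y \<in> M" for y
    proof -
      have "cmod (cinner (T y) x) \<le> norm (T y) * norm x" by (rule Cauchy_Schwarz_cinner)
      also have "\<dots> \<le> K * norm y * norm x" using K[OF that] by (intro mult_right_mono) auto
      finally show ?thesis by (simp add: mult_ac)
    qed
  qed (auto simp: bounded_opD[OF T] cinner_add_left cinner_scaleC_left)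
  then obtain S where SM: "\<And>x. x \<in> M \<Longrightarrow> S x \<in> M"
    and S': "\<And>x y. x \<in> M \<Longrightarrow> y \<in> M \<Longrightarrow> cinner (T y) x = cinner y (S x)"
    by metis
  have S: "cinner (S x) y = cinner x (T y)" if "x \<in> M" "y \<in> M" for x y
    using S'[OF that] by (metis cinner_commute)
  have uniq: "u = v" if "u \<in> M" "v \<in> M" "\<And>y. y \<in> M \<Longrightarrow> cinner u y = cinner v y" for u v
  proof -
    have "cinner (u - v) (u - v) = 0"
      using that(3)[of "u - v"] MD(5)[of u v] that(1,2) by (simp add: cinner_diff_left)
    then show ?thesis by (simp add: cinner_self)
  qed
  have "bounded_op M S"
    unfolding bounded_op_def
  proof (intro conjI ballI allI exI[of _ K])
    fix x y assume "x \<in> M" "y \<in> M"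
    then show "S (x + y) = S x + S y"
      by (intro uniq) (auto simp: SM MD S cinner_add_left)
  next
    fix c x assume "x \<in> M"
    then show "S (c *\<^sub>C x) = c *\<^sub>C S x"
      by (intro uniq) (auto simp: SM MD S cinner_scaleC_left)
  next
    fix x assume x: "x \<in> M"
    have "complex_of_real ((norm (S x))\<^sup>2) = cinner x (T (S x))"
      by (simp only: cinner_self[symmetric] S[OF x SM[OF x]])
    then have "(norm (S x))\<^sup>2 \<le> norm x * norm (T (S x))"
      using Cauchy_Schwarz_cinner[of x "T (S x)"]
      by (metis abs_of_nonneg norm_of_real zero_le_power2)
    also have "\<dots> \<le> norm x * (K * norm (S x))"
      by (intro mult_left_mono K SM x) auto
    finally have "norm (S x) * norm (S x) \<le> (K * norm x) * norm (S x)"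
      by (simp add: power2_eq_square mult_ac)
    then show "norm (S x) \<le> K * norm x"
      using K0 by (cases "S x = 0") auto
  qed (auto simp: SM)
  with S show ?thesis by blast
qed

lemma adjoint_op:
  assumes "closed_csubspace M" "bounded_op M T"
  shows "bounded_op M (adjoint_op M T)"
    and "x \<in> M \<Longrightarrow> y \<in> M \<Longrightarrow> cinner (adjoint_op M T x) y = cinner x (T y)"
  using someI_ex[OF adjoint_exists[OF assms]] unfolding adjoint_op_def by auto

text \<open>Pairing the operator inequality with \<open>x\<close> moves each adjoint to the other
  side. All later arguments use the class in this form, which also reads ||T T x||^2 - ||T x||^2
  \<le> r^2 (||T x||^2 - ||x||^2).\<close>

lemma C_alpha_iff:
  "(M, T) \<in> C_alpha r \<longleftrightarrow> closed_csubspace M \<and> invertible_op M T \<and>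
     (\<forall>x\<in>M. (norm (T (T x)))\<^sup>2 + r\<^sup>2 * (norm x)\<^sup>2 \<le> (1 + r\<^sup>2) * (norm (T x))\<^sup>2)"
proof -
  have "(cinner (- (adjoint_op M T ^^ 2) ((T ^^ 2) x) + (1 + r\<^sup>2) *\<^sub>R adjoint_op M T (T x)
      - r\<^sup>2 *\<^sub>R x) x) =
      complex_of_real (- (norm (T (T x)))\<^sup>2 + (1 + r\<^sup>2) * (norm (T x))\<^sup>2 - r\<^sup>2 * (norm x)\<^sup>2)"
    if M: "closed_csubspace M" and T: "bounded_op M T" and x: "x \<in> M" for x
  proof -
    note A = adjoint_op[OF M T] and TM = bounded_opD(1)[OF T]
    have "cinner (adjoint_op M T (adjoint_op M T (T (T x)))) x = cinner (T (T x)) (T (T x))"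
      using x by (simp add: A(2) TM bounded_opD(1)[OF A(1)])
    moreover have "cinner (adjoint_op M T (T x)) x = cinner (T x) (T x)"
      using x by (simp add: A(2) TM)
    ultimately show ?thesis
      by (simp add: numeral_2_eq_2 cinner_add_left cinner_diff_left cinner_scaleR_left cinner_self)
  qed
  then show ?thesis
    unfolding C_alpha_def positive_op_def by (auto simp: invertible_op_def add.commute)
qed

lemma C_alpha_contraction:
  assumes T: "(M, T) \<in> C_alpha r" and r: "0 < r" "r < 1" and x: "x \<in> M"
  shows "norm (T x) \<le> norm x"
proof (rule ccontr)
  assume "\<not> ?thesis"
  then have gt: "(norm (T x))\<^sup>2 > (norm x)\<^sup>2" by (simp add: power_strict_mono)
  obtain S where Tb: "bounded_op M T" and Sb: "bounded_op M S"
    and ST: "\<And>x. x \<in> M \<Longrightarrow> S (T x) = x" and TS: "\<And>x. x \<in> M \<Longrightarrow> T (S x) = x"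
    using T unfolding C_alpha_iff invertible_op_def by blast
  \<comment> \<open>The backward orbit starts at \<open>T x\<close>, so that \<open>u 1\<close> is
    \<open>x\<close> and \<open>D 0\<close> is the assumed excess. Going backwards, the inequality
    of the class pushes the differences up.\<close>
  define u where "u k = (S ^^ k) (T x)" for k
  have uM: "u k \<in> M" for k
    by (induction k) (auto simp: u_def bounded_opD(1)[OF Tb x] bounded_opD(1)[OF Sb])
  have Tu: "T (u (Suc k)) = u k" for k
    using TS[OF uM[of k]] by (simp add: u_def)
  define D where "D k = (norm (u k))\<^sup>2 - (norm (u (Suc k)))\<^sup>2" for k
  have step: "D k \<le> r\<^sup>2 * D (Suc k)" for k
    using T uM[of "Suc (Suc k)"] unfolding C_alpha_iff D_def by (auto simp: Tu algebra_simps)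
  have D0: "D 0 > 0" using gt ST[OF x] by (simp add: D_def u_def)
  have Dk: "D k \<ge> D 0" for k
  proof (induction k)
    case (Suc k)
    \<comment> \<open>Positivity comes first: only then may the factor \<open>r\<^sup>2 < 1\<close>
      be dropped from the right-hand side of \<open>step\<close>.\<close>
    have "0 < r\<^sup>2 * D (Suc k)" using Suc D0 step[of k] by linarith
    then have "D (Suc k) > 0" using r by (simp add: zero_less_mult_iff)
    then have "r\<^sup>2 * D (Suc k) \<le> D (Suc k)"
      using r by (simp add: power_le_one)
    then show ?case using step[of k] Suc by linarith
  qed simp
  have "(norm (u k))\<^sup>2 \<le> (norm (u 0))\<^sup>2 - real k * D 0" for k
  proof (induction k)
    case (Suc k)
    then show ?case using Dk[of k] unfolding D_def by (simp add: algebra_simps)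
  qed simp
  moreover obtain k :: nat where "(norm (u 0))\<^sup>2 / D 0 < real k" using reals_Archimedean2 by blast
  ultimately show False
    using D0 by (smt (verit) pos_divide_less_eq zero_le_power2)
qed

section \<open>Polynomials of an operator\<close>

lemma poly_op_eq_sum:
  assumes "degree p \<le> n"
  shows "poly_op p T x = (\<Sum>i\<le>n. coeff p i *\<^sub>C (T ^^ i) x)"
  unfolding poly_op_def using assms
  by (intro sum.mono_neutral_left) (auto simp: coeff_eq_0)

lemma poly_op_0 [simp]: "poly_op 0 T x = 0"
  by (simp add: poly_op_def)

lemma poly_op_add: "poly_op (p + q) T x = poly_op p T x + poly_op q T x"
proof -
  define n where "n = max (degree p) (degree q)"
  have "degree (p + q) \<le> n" by (simp add: n_def degree_add_le_max)
  then show ?thesis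
    by (simp add: poly_op_eq_sum[of _ n] n_def scaleC_add_left sum.distrib)
qed

lemma poly_op_smult: "poly_op (smult c p) T x = c *\<^sub>C poly_op p T x"
  unfolding poly_op_eq_sum[OF degree_smult_le] poly_op_eq_sum[OF order_refl, of p]
  by (simp add: scaleC_sum_right scaleC_scaleC)

lemma bounded_op_funpow:
  assumes "bounded_op M T"
  shows "bounded_op M (T ^^ n)"
proof (induction n)
  case 0
  then show ?case by (auto simp: bounded_op_def intro!: exI[of _ 1])
next
  case (Suc n)
  obtain K where K: "K \<ge> 0" "\<And>x. x \<in> M \<Longrightarrow> norm (T x) \<le> K * norm x"
    using bounded_op_norm_bound[OF assms] by blast
  obtain L where L: "\<And>x. x \<in> M \<Longrightarrow> norm ((T ^^ n) x) \<le> L * norm x"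
    using bounded_op_norm_bound[OF Suc] by blast
  note T = bounded_opD[OF assms] and Tn = bounded_opD[OF Suc]
  show ?case
    unfolding bounded_op_def
  proof (intro conjI ballI allI exI[of _ "K * L"])
    fix x assume x: "x \<in> M"
    have "norm ((T ^^ Suc n) x) \<le> K * norm ((T ^^ n) x)" using K(2) Tn(1)[OF x] by simp
    also have "\<dots> \<le> K * (L * norm x)" using K(1) L[OF x] by (intro mult_left_mono)
    finally show "norm ((T ^^ Suc n) x) \<le> K * L * norm x" by (simp add: mult.assoc)
  qed (auto simp: T Tn)
qed

locale subspace_operator =
  fixes M :: "'a::complex_hilbert set" and T :: "'a \<Rightarrow> 'a"
  assumes M: "closed_csubspace M" and T: "bounded_op M T"
begin

lemmas MD = closed_csubspaceD[OF M]
lemmas TD = bounded_opD[OF T]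
lemmas TnD = bounded_opD[OF bounded_op_funpow[OF T]]

lemma poly_op_closed: "x \<in> M \<Longrightarrow> poly_op p T x \<in> M"
  unfolding poly_op_def by (intro MD TnD)

lemma bounded_op_poly_op: "bounded_op M (poly_op p T)"
  unfolding bounded_op_def
proof (intro conjI ballI allI)
  fix x y assume "x \<in> M" "y \<in> M"
  then show "poly_op p T (x + y) = poly_op p T x + poly_op p T y"
    by (simp add: poly_op_def TnD scaleC_add_right sum.distrib)
next
  fix c x assume "x \<in> M"
  then show "poly_op p T (c *\<^sub>C x) = c *\<^sub>C poly_op p T x"
    by (simp add: poly_op_def TnD scaleC_sum_right scaleC_scaleC mult.commute)
next
  have "\<exists>K. \<forall>x\<in>M. norm ((T ^^ i) x) \<le> K * norm x" for i
    using bounded_op_funpow[OF T, of i] by (simp add: bounded_op_def)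
  then obtain K where K: "\<And>i x. x \<in> M \<Longrightarrow> norm ((T ^^ i) x) \<le> K i * norm x"
    by metis
  show "\<exists>K. \<forall>x\<in>M. norm (poly_op p T x) \<le> K * norm x"
  proof (intro exI ballI)
    fix x assume x: "x \<in> M"
    have "norm (poly_op p T x) \<le> (\<Sum>i\<le>degree p. cmod (coeff p i) * (K i * norm x))"
      unfolding poly_op_def using K[OF x]
      by (intro sum_norm_le) (auto intro: mult_left_mono)
    then show "norm (poly_op p T x) \<le> (\<Sum>i\<le>degree p. cmod (coeff p i) * K i) * norm x"
      by (simp add: sum_distrib_right mult.assoc)
  qed
qed (rule poly_op_closed)

lemma poly_op_pCons:
  assumes x: "x \<in> M"
  shows "poly_op (pCons c p) T x = c *\<^sub>C x + T (poly_op p T x)"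
proof -
  have "poly_op (pCons c p) T x = (\<Sum>i\<le>Suc (degree p). coeff (pCons c p) i *\<^sub>C (T ^^ i) x)"
    by (rule poly_op_eq_sum) (simp add: degree_pCons_le)
  also have "\<dots> = c *\<^sub>C x + (\<Sum>i\<le>degree p. T (coeff p i *\<^sub>C (T ^^ i) x))"
    unfolding sum.atMost_Suc_shift using x by (simp add: TD TnD)
  also have "(\<Sum>i\<le>degree p. T (coeff p i *\<^sub>C (T ^^ i) x)) = T (poly_op p T x)"
    unfolding poly_op_def using x by (subst bounded_op_sum[OF M T]) (auto intro: MD TnD)
  finally show ?thesis .
qed

lemma poly_op_mult:
  assumes x: "x \<in> M"
  shows "poly_op (p * q) T x = poly_op p T (poly_op q T x)"
proof (induction p)
  case (pCons c p)
  then show ?case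
    using x by (simp add: poly_op_add poly_op_smult poly_op_pCons poly_op_closed)
qed simp

lemma poly_op_linear: "x \<in> M \<Longrightarrow> poly_op [:a, b:] T x = a *\<^sub>C x + b *\<^sub>C T x"
  by (simp add: poly_op_pCons TD bounded_op_zero[OF M T])

lemma poly_op_monom: "x \<in> M \<Longrightarrow> poly_op (monom c n) T x = c *\<^sub>C (T ^^ n) x"
proof (induction n)
  case (Suc n)
  then show ?case by (simp add: monom_Suc poly_op_pCons TD TnD)
qed (simp add: monom_0 poly_op_pCons bounded_op_zero[OF M T])

text \<open>Commutation is inherited from the polynomial ring: both sides evaluate
  \<open>p * monom 1 n\<close> at \<open>T\<close>.\<close>

lemma funpow_poly_op: "x \<in> M \<Longrightarrow> (T ^^ n) (poly_op p T x) = poly_op p T ((T ^^ n) x)"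
  using poly_op_mult[of x "monom 1 n" p] poly_op_mult[of x p "monom 1 n"]
  by (simp add: poly_op_monom poly_op_closed mult.commute)

end

section \<open>The von Neumann inequality\<close>

lemma sum_rotate: "(\<Sum>k\<in>A. \<Sum>i\<in>B. \<Sum>j\<in>C. f k i j) = (\<Sum>i\<in>B. \<Sum>j\<in>C. \<Sum>k\<in>A. f k i j)"
proof -
  have "(\<Sum>k\<in>A. \<Sum>i\<in>B. \<Sum>j\<in>C. f k i j) = (\<Sum>i\<in>B. \<Sum>k\<in>A. \<Sum>j\<in>C. f k i j)"
    by (rule sum.swap)
  also have "\<dots> = (\<Sum>i\<in>B. \<Sum>j\<in>C. \<Sum>k\<in>A. f k i j)"
    by (intro sum.cong refl) (rule sum.swap)
  finally show ?thesis .
qed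

text \<open>The sum is geometric with ratio
  \<open>\<zeta> = \<omega> ^ i * cnj (\<omega> ^ j)\<close>, an \<open>N\<close>-th root of unity
  that primitivity and i, j < N keep away from 1 unless \<open>i = j\<close>.\<close>

lemma root_of_unity_orthogonality:
  fixes \<omega> :: complex
  assumes "\<omega> ^ N = 1" "cmod \<omega> = 1" and prim: "\<And>m. 0 < m \<Longrightarrow> m < N \<Longrightarrow> \<omega> ^ m \<noteq> 1"
    and "i < N" "j < N"
  shows "(\<Sum>k<N. \<omega> ^ (k * i) * cnj (\<omega> ^ (k * j))) = (if i = j then of_nat N else 0)"
proof -
  define \<zeta> where "\<zeta> = \<omega> ^ i * cnj (\<omega> ^ j)"
  have pw: "\<omega> ^ (k * i) * cnj (\<omega> ^ (k * j)) = \<zeta> ^ k" for k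
    by (simp add: \<zeta>_def power_mult_distrib flip: power_mult) (simp add: mult.commute)
  have unit: "\<omega> ^ j * cnj (\<omega> ^ j) = 1" for j
    using assms(2) by (simp only: complex_norm_square[symmetric]) (simp add: norm_power)
  show ?thesis
  proof (cases "i = j")
    case True
    then have "\<zeta> = 1" using unit by (simp add: \<zeta>_def)
    then show ?thesis unfolding pw using True by simp
  next
    case False
    have neq: "\<omega> ^ m \<noteq> \<omega> ^ n" if "m < n" "n < N" for m n
    proof
      assume "\<omega> ^ m = \<omega> ^ n"
      moreover have "\<omega> ^ m * \<omega> ^ (n - m) = \<omega> ^ n" using that by (simp only: power_add[symmetric]) simp
      ultimately have "\<omega> ^ m * 1 = \<omega> ^ m * \<omega> ^ (n - m)" by simp
      then have "\<omega> ^ (n - m) = 1"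
        using assms(2) by (metis mult_left_cancel norm_zero power_not_zero zero_neq_one)
      then show False using prim[of "n - m"] that by simp
    qed
    have "\<zeta> \<noteq> 1"
    proof
      assume "\<zeta> = 1"
      then have "\<omega> ^ i * (\<omega> ^ j * cnj (\<omega> ^ j)) = \<omega> ^ j" by (simp add: \<zeta>_def mult_ac)
      then have "\<omega> ^ i = \<omega> ^ j" unfolding unit by simp
      then show False using neq[of i j] neq[of j i] False assms(4,5) by (metis nat_neq_iff)
    qed
    moreover have "\<zeta> ^ N = (\<omega> ^ N) ^ i * cnj ((\<omega> ^ N) ^ j)"
      by (simp add: \<zeta>_def power_mult_distrib flip: power_mult) (simp add: mult.commute)
    then have "\<zeta> ^ N = 1" using assms(1) by simp
    ultimately show ?thesis
      unfolding pw using False by (simp add: sum_gp_strict)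
  qed
qed

lemma primitive_root_of_unity_exists:
  assumes "N > 0"
  obtains \<omega> :: complex where "\<omega> ^ N = 1" "cmod \<omega> = 1" "\<And>m. 0 < m \<Longrightarrow> m < N \<Longrightarrow> \<omega> ^ m \<noteq> 1"
proof -
  define \<omega> where "\<omega> = cis (2 * pi / real N)"
  have pow: "\<omega> ^ m = exp (2 * of_real pi * \<i> * of_nat m / of_nat N)" for m
    unfolding \<omega>_def Complex.DeMoivre by (simp add: cis_conv_exp mult_ac)
  show ?thesis
  proof (rule that)
    show "cmod \<omega> = 1" by (simp add: \<omega>_def)
    show "\<omega> ^ N = 1" using assms complex_root_unity_eq_1[of N N] by (simp add: pow)
    show "\<omega> ^ m \<noteq> 1" if "0 < m" "m < N" for m
      using that assms complex_root_unity_eq_1[of N m] by (simp add: pow nat_dvd_not_less)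
  qed
qed

lemma discrete_fourier_parseval:
  fixes z :: "nat \<Rightarrow> 'a::complex_hilbert"
  assumes "\<omega> ^ N = 1" "cmod \<omega> = 1" "\<And>m. 0 < m \<Longrightarrow> m < N \<Longrightarrow> \<omega> ^ m \<noteq> 1"
  shows "(\<Sum>k<N. (norm (\<Sum>i<N. \<omega> ^ (k * i) *\<^sub>C z i))\<^sup>2) = real N * (\<Sum>i<N. (norm (z i))\<^sup>2)"
proof -
  note orth = root_of_unity_orthogonality[OF assms]
  have "complex_of_real (\<Sum>k<N. (norm (\<Sum>i<N. \<omega> ^ (k * i) *\<^sub>C z i))\<^sup>2) =
      (\<Sum>k<N. \<Sum>i<N. \<Sum>j<N. \<omega> ^ (k * i) * cnj (\<omega> ^ (k * j)) * cinner (z i) (z j))"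
    unfolding of_real_sum
    by (simp only: cinner_self[symmetric] cinner_sum_left)
      (simp only: cinner_sum_right cinner_scaleC_left cinner_scaleC_right mult.assoc mult.left_commute)
  also have "\<dots> = (\<Sum>i<N. \<Sum>j<N. (\<Sum>k<N. \<omega> ^ (k * i) * cnj (\<omega> ^ (k * j))) * cinner (z i) (z j))"
    unfolding sum_distrib_right by (rule sum_rotate)
  also have "\<dots> = (\<Sum>i<N. \<Sum>j<N. if i = j then of_nat N * cinner (z i) (z j) else 0)"
    by (intro sum.cong refl) (simp add: orth del: complex_cnj_power)
  also have "\<dots> = complex_of_real (real N * (\<Sum>i<N. (norm (z i))\<^sup>2))"
    by (simp add: cinner_self sum_distrib_left)
  finally show ?thesis by (simp only: of_real_eq_iff)
qed

context subspace_operator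
begin

text \<open>
  For \<open>\<delta>(u) = \<parallel>u\<parallel>\<^sup>2 - \<parallel>T u\<parallel>\<^sup>2\<close> the sum of \<open>\<delta>(T\<^sup>i u)\<close> telescopes to \<open>\<parallel>u\<parallel>\<^sup>2\<close>. On the sequence \<open>(T\<^sup>i x)\<close>
  the operator \<open>p(T)\<close> acts as a shift polynomial, which the discrete Fourier transform turns into
  multiplication by the values of \<open>p\<close> at roots of unity.
\<close>

lemma von_Neumann_strict_contraction:
  assumes \<rho>: "0 \<le> \<rho>" "\<rho> < 1" and T\<rho>: "\<And>x. x \<in> M \<Longrightarrow> norm (T x) \<le> \<rho> * norm x"
    and C: "\<And>z. cmod z = 1 \<Longrightarrow> cmod (poly p z) \<le> C" and x: "x \<in> M"
  shows "norm (poly_op p T x) \<le> C * norm x"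
proof -
  define \<delta> where "\<delta> u = (norm u)\<^sup>2 - (norm (T u))\<^sup>2" for u
  have T1: "norm (T u) \<le> norm u" if "u \<in> M" for u
    using T\<rho>[OF that] \<rho> mult_right_mono[of \<rho> 1 "norm u"] by simp
  have \<delta>0: "\<delta> u \<ge> 0" if "u \<in> M" for u
    using T1[OF that] by (simp add: \<delta>_def power_mono)
  have \<delta>_scale: "\<delta> (c *\<^sub>C u) = (cmod c)\<^sup>2 * \<delta> u" if "u \<in> M" for c u
    using that by (simp add: \<delta>_def TD power_mult_distrib algebra_simps)
  have \<delta>_telescope: "(\<Sum>i<n. \<delta> ((T ^^ i) u)) = (norm u)\<^sup>2 - (norm ((T ^^ n) u))\<^sup>2" for n u
    by (induction n) (auto simp: \<delta>_def)
  have C0: "C \<ge> 0" using order_trans[OF norm_ge_zero C[of 1]] by simp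
  define v where "v = poly_op p T x"
  have vM: "v \<in> M" using x by (simp add: v_def poly_op_closed)
  have main: "(norm v)\<^sup>2 - (norm ((T ^^ n) v))\<^sup>2 \<le> C\<^sup>2 * (norm x)\<^sup>2" for n
  proof -
    \<comment> \<open>Large enough that shifting an index \<open>i < n\<close> by
      \<open>l \<le> degree p\<close> stays below \<open>N\<close>: nothing wraps around modulo
      \<open>N\<close>.\<close>
    define N where "N = n + degree p + 1"
    have N: "N > 0" by (simp add: N_def)
    obtain \<omega> :: complex where \<omega>: "\<omega> ^ N = 1" "cmod \<omega> = 1"
      "\<And>m. 0 < m \<Longrightarrow> m < N \<Longrightarrow> \<omega> ^ m \<noteq> 1"
      using primitive_root_of_unity_exists[OF N] by blast
    then have \<omega>': "cnj \<omega> ^ N = 1" "cmod (cnj \<omega>) = 1" "\<And>m. 0 < m \<Longrightarrow> m < N \<Longrightarrow> cnj \<omega> ^ m \<noteq> 1"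
      by (metis complex_cnj_power complex_cnj_one complex_cnj_cnj complex_mod_cnj)+
    \<comment> \<open>\<open>\<delta>\<close> is a difference of squared norms of linear images, so
      Parseval passes to it.\<close>
    have \<delta>_parseval: "(\<Sum>k<N. \<delta> (\<Sum>i<N. \<zeta> ^ (k * i) *\<^sub>C z i)) = real N * (\<Sum>i<N. \<delta> (z i))"
      if \<zeta>: "\<zeta> ^ N = 1" "cmod \<zeta> = 1" "\<And>m. 0 < m \<Longrightarrow> m < N \<Longrightarrow> \<zeta> ^ m \<noteq> 1"
        and z: "\<And>i. z i \<in> M" for \<zeta> z
    proof -
      have "T (\<Sum>i<N. \<zeta> ^ (k * i) *\<^sub>C z i) = (\<Sum>i<N. \<zeta> ^ (k * i) *\<^sub>C T (z i))" for k
        by (subst bounded_op_sum[OF M T]) (auto simp: z TD MD)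
      then show ?thesis
        unfolding \<delta>_def
        using discrete_fourier_parseval[OF \<zeta>, of z] discrete_fourier_parseval[OF \<zeta>, of "\<lambda>i. T (z i)"]
        by (simp add: sum_subtractf right_diff_distrib)
    qed
    \<comment> \<open>Fourier transform of the orbit of \<open>x\<close>, with conjugate roots so
      that the sums in \<open>coeffs\<close> invert it.\<close>
    define y where "y k = (\<Sum>j<N. cnj \<omega> ^ (k * j) *\<^sub>C (T ^^ j) x)" for k
    have yM: "y k \<in> M" for k unfolding y_def using x by (intro MD TnD)
    have \<delta>y: "(\<Sum>k<N. \<delta> (y k)) \<le> real N * (norm x)\<^sup>2"
      unfolding y_def using x
      by (subst \<delta>_parseval[OF \<omega>']) (auto simp: TnD \<delta>_telescope intro: mult_left_mono)
    \<comment> \<open>Multiplying the k-th transform by \<open>poly p (\<omega> ^ k)\<close> applies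
      \<open>p\<close> to the index shift, and along an orbit that shift is
      \<open>T\<close>.\<close>
    have coeffs: "(\<Sum>k<N. \<omega> ^ (i * k) *\<^sub>C poly p (\<omega> ^ k) *\<^sub>C y k) = of_nat N *\<^sub>C (T ^^ i) v"
      if i: "i < n" for i
    proof -
      have "(\<Sum>k<N. \<omega> ^ (i * k) *\<^sub>C poly p (\<omega> ^ k) *\<^sub>C y k) =
          (\<Sum>k<N. \<Sum>l\<le>degree p. \<Sum>j<N.
            (coeff p l * (\<omega> ^ (k * (l + i)) * cnj (\<omega> ^ (k * j)))) *\<^sub>C (T ^^ j) x)"
      proof (rule sum.cong[OF refl])
        fix k
        have "\<omega> ^ (i * k) *\<^sub>C poly p (\<omega> ^ k) *\<^sub>C y k =
            (\<Sum>l\<le>degree p. (\<omega> ^ (i * k) * (coeff p l * \<omega> ^ (k * l))) *\<^sub>C y k)"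
          by (simp only: poly_altdef scaleC_sum_left scaleC_sum_right scaleC_scaleC power_mult)
        also have "\<dots> = (\<Sum>l\<le>degree p. \<Sum>j<N.
            (coeff p l * (\<omega> ^ (k * (l + i)) * cnj (\<omega> ^ (k * j)))) *\<^sub>C (T ^^ j) x)"
          unfolding y_def scaleC_sum_right scaleC_scaleC
          by (intro sum.cong refl arg_cong[where f = "\<lambda>c. c *\<^sub>C _"])
            (simp add: power_add distrib_left mult_ac)
        finally show "\<omega> ^ (i * k) *\<^sub>C poly p (\<omega> ^ k) *\<^sub>C y k = (\<Sum>l\<le>degree p. \<Sum>j<N.
            (coeff p l * (\<omega> ^ (k * (l + i)) * cnj (\<omega> ^ (k * j)))) *\<^sub>C (T ^^ j) x)" .
      qed
      also have "\<dots> = (\<Sum>l\<le>degree p. \<Sum>j<N.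
            (coeff p l * (\<Sum>k<N. \<omega> ^ (k * (l + i)) * cnj (\<omega> ^ (k * j)))) *\<^sub>C (T ^^ j) x)"
        unfolding sum_distrib_left scaleC_sum_left by (rule sum_rotate)
      also have "\<dots> = (\<Sum>l\<le>degree p. \<Sum>j<N.
            if l + i = j then (coeff p l * of_nat N) *\<^sub>C (T ^^ j) x else 0)"
        using i by (intro sum.cong refl, subst root_of_unity_orthogonality[OF \<omega>])
          (auto simp: N_def)
      also have "\<dots> = (\<Sum>l\<le>degree p. (coeff p l * of_nat N) *\<^sub>C (T ^^ (l + i)) x)"
        using i by (intro sum.cong refl) (auto simp: N_def)
      also have "\<dots> = of_nat N *\<^sub>C poly_op p T ((T ^^ i) x)"
        by (simp add: poly_op_def scaleC_sum_right scaleC_scaleC mult.commute funpow_add)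
      also have "\<dots> = of_nat N *\<^sub>C (T ^^ i) v"
        using x by (simp add: v_def funpow_poly_op)
      finally show ?thesis .
    qed
    have "(real N)\<^sup>2 * ((norm v)\<^sup>2 - (norm ((T ^^ n) v))\<^sup>2) = (\<Sum>i<n. \<delta> (of_nat N *\<^sub>C (T ^^ i) v))"
      using vM by (simp add: \<delta>_scale TnD \<delta>_telescope flip: sum_distrib_left)
    also have "\<dots> = (\<Sum>i<n. \<delta> (\<Sum>k<N. \<omega> ^ (i * k) *\<^sub>C poly p (\<omega> ^ k) *\<^sub>C y k))"
      by (simp add: coeffs)
    \<comment> \<open>For \<open>i \<ge> n\<close> wraparound may spoil the vectors, but
      \<open>\<delta>\<close> is nonnegative on \<open>M\<close>, so they can be added to complete a
      full Fourier sum.\<close>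
    also have "\<dots> \<le> (\<Sum>i<N. \<delta> (\<Sum>k<N. \<omega> ^ (i * k) *\<^sub>C poly p (\<omega> ^ k) *\<^sub>C y k))"
      by (intro sum_mono2 \<delta>0 MD yM) (auto simp: N_def)
    also have "\<dots> = real N * (\<Sum>k<N. (cmod (poly p (\<omega> ^ k)))\<^sup>2 * \<delta> (y k))"
      using yM by (subst \<delta>_parseval[OF \<omega>]) (auto simp: MD \<delta>_scale)
    also have "\<dots> \<le> real N * (\<Sum>k<N. C\<^sup>2 * \<delta> (y k))"
      using C \<omega>(2) by (intro mult_left_mono sum_mono mult_right_mono power_mono \<delta>0 yM)
        (auto simp: norm_power)
    also have "\<dots> \<le> real N * (C\<^sup>2 * (real N * (norm x)\<^sup>2))"
      using \<delta>y by (auto simp flip: sum_distrib_left intro!: mult_left_mono)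
    finally have "(real N)\<^sup>2 * ((norm v)\<^sup>2 - (norm ((T ^^ n) v))\<^sup>2) \<le> (real N)\<^sup>2 * (C\<^sup>2 * (norm x)\<^sup>2)"
      by (simp add: power2_eq_square mult_ac)
    then show ?thesis using N by simp
  qed
  \<comment> \<open>Here strictness enters: it makes the subtracted term of \<open>main\<close>
    vanish in the limit.\<close>
  have Tn: "norm ((T ^^ n) v) \<le> \<rho> ^ n * norm v" for n
  proof (induction n)
    case (Suc n)
    then show ?case
      using T\<rho>[OF TnD(1)[OF vM, of n]] mult_left_mono[OF Suc \<rho>(1)] by simp
  qed simp
  have "(\<lambda>n. norm ((T ^^ n) v)) \<longlonglongrightarrow> 0"
  proof (rule tendsto_sandwich[OF _ _ tendsto_const])
    show "(\<lambda>n. \<rho> ^ n * norm v) \<longlonglongrightarrow> 0"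
      using \<rho> by (intro tendsto_mult_left_zero LIMSEQ_power_zero) auto
  qed (use Tn in auto)
  then have "(\<lambda>n. (norm v)\<^sup>2 - (norm ((T ^^ n) v))\<^sup>2) \<longlonglongrightarrow> (norm v)\<^sup>2 - 0\<^sup>2"
    by (intro tendsto_intros)
  then have "(norm v)\<^sup>2 - 0\<^sup>2 \<le> C\<^sup>2 * (norm x)\<^sup>2"
    by (rule LIMSEQ_le_const2) (use main in auto)
  then have "(norm v)\<^sup>2 \<le> (C * norm x)\<^sup>2" by (simp add: power_mult_distrib)
  then show ?thesis
    unfolding v_def[symmetric] by (rule power2_le_imp_le) (simp add: C0)
qed

end

section \<open>Contractions: from polynomials to rational functions\<close>

locale contraction_operator = subspace_operator +
  assumes contraction: "x \<in> M \<Longrightarrow> norm (T x) \<le> norm x"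
begin

text \<open>Apply the strict case to \<open>t *\<^sub>R T\<close> with \<open>t < 1\<close> and let
  t tend to 1; for a fixed polynomial and vector the dependence on t is polynomial, hence
  continuous.\<close>

lemma von_Neumann_poly:
  assumes C: "\<And>z. cmod z \<le> 1 \<Longrightarrow> cmod (poly p z) \<le> C" and x: "x \<in> M"
  shows "norm (poly_op p T x) \<le> C * norm x"
proof -
  have scaled: "norm (\<Sum>i\<le>degree p. coeff p i *\<^sub>C t ^ i *\<^sub>R (T ^^ i) x) \<le> C * norm x"
    if t: "0 \<le> t" "t < 1" for t
  proof -
    define S where "S = (\<lambda>x. t *\<^sub>R T x)"
    have S_bound: "norm (S u) \<le> t * norm u" if "u \<in> M" for u
      using t contraction[OF that] by (simp add: S_def mult_left_mono)
    interpret S: subspace_operator M S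
    proof
      show "bounded_op M S"
        unfolding bounded_op_def using S_bound
        by (auto simp: S_def TD MD scaleR_scaleC scaleC_add_right scaleC_scaleC mult.commute)
    qed (rule M)
    have "(S ^^ i) x = t ^ i *\<^sub>R (T ^^ i) x" for i
    proof (induction i)
      case (Suc i)
      have "T (t ^ i *\<^sub>R (T ^^ i) x) = t ^ i *\<^sub>R T ((T ^^ i) x)"
        using x by (simp add: scaleR_scaleC TD TnD)
      then show ?case using Suc by (simp add: S_def)
    qed simp
    then have "poly_op p S x = (\<Sum>i\<le>degree p. coeff p i *\<^sub>C t ^ i *\<^sub>R (T ^^ i) x)"
      by (simp add: poly_op_def)
    then show ?thesis
      using S.von_Neumann_strict_contraction[OF t S_bound _ x, of p C] C by simp
  qed
  let ?t = "\<lambda>n. real n / real (Suc n)"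
  have "(\<lambda>n. norm (\<Sum>i\<le>degree p. coeff p i *\<^sub>C ?t n ^ i *\<^sub>R (T ^^ i) x))
      \<longlonglongrightarrow> norm (\<Sum>i\<le>degree p. coeff p i *\<^sub>C 1 ^ i *\<^sub>R (T ^^ i) x)"
    by (intro tendsto_intros bounded_linear.tendsto[OF bounded_linear_scaleC] LIMSEQ_n_over_Suc_n)
  then have "norm (\<Sum>i\<le>degree p. coeff p i *\<^sub>C 1 ^ i *\<^sub>R (T ^^ i) x) \<le> C * norm x"
    by (rule LIMSEQ_le_const2) (use scaled in auto)
  then show ?thesis by (simp add: poly_op_def)
qed

text \<open>A solution of \<open>z *\<^sub>C y - T y = x\<close> is a fixed point of y = z^(-1) (x +
  T y), a contraction with factor 1/|z| on the complete set \<open>M\<close>. The lower bound |z| -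
  1 gives injectivity and bounds the inverse.\<close>

lemma invertible_outside_disk:
  assumes z: "cmod z > 1"
  shows "invertible_op M (\<lambda>x. z *\<^sub>C x - T x)"
proof -
  define A where "A = (\<lambda>x. z *\<^sub>C x - T x)"
  have z0: "z \<noteq> 0" using z by auto
  have A: "bounded_op M A"
    unfolding bounded_op_def
  proof (intro conjI ballI allI exI[of _ "cmod z + 1"])
    fix x assume x: "x \<in> M"
    show "norm (A x) \<le> (cmod z + 1) * norm x"
      using norm_triangle_ineq4[of "z *\<^sub>C x" "T x"] contraction[OF x]
      by (simp add: A_def algebra_simps)
  qed (auto simp: A_def MD TD scaleC_add_right scaleC_diff_right scaleC_scaleC mult.commute)
  have lower: "(cmod z - 1) * norm x \<le> norm (A x)" if "x \<in> M" for x
    using norm_triangle_ineq2[of "z *\<^sub>C x" "T x"] contraction[OF that]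
    by (simp add: A_def algebra_simps)
  have surj: "\<exists>y\<in>M. A y = x" if x: "x \<in> M" for x
  proof -
    define F where "F y = inverse z *\<^sub>C (x + T y)" for y
    have "\<exists>!y. y \<in> M \<and> F y = y"
    proof (rule Banach_fix)
      show "complete M" using MD(1) by (simp add: complete_eq_closed)
      show "M \<noteq> {}" using MD(3) by auto
      show "0 \<le> inverse (cmod z)" "inverse (cmod z) < 1" using z by (auto simp: inverse_less_1_iff)
      show "F ` M \<subseteq> M" using x by (auto simp: F_def MD TD)
      show "dist (F y) (F w) \<le> inverse (cmod z) * dist y w"
        if yw: "y \<in> M" "w \<in> M" for y w
      proof -
        have "F y - F w = inverse z *\<^sub>C T (y - w)"
          using yw by (simp add: F_def bounded_op_diff[OF M T] flip: scaleC_diff_right)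
        then show "dist (F y) (F w) \<le> inverse (cmod z) * dist y w"
          using contraction[OF MD(5)[OF yw]]
          by (simp add: dist_norm norm_inverse mult_left_mono)
      qed
    qed
    then obtain y where y: "y \<in> M" "F y = y" by blast
    have "z *\<^sub>C F y = x + T y" by (simp add: F_def scaleC_scaleC z0)
    then have "z *\<^sub>C y = x + T y" by (simp only: y(2))
    then show ?thesis using y(1) by (intro bexI[of _ y]) (auto simp: A_def)
  qed
  have inj: "x = y" if "x \<in> M" "y \<in> M" "A x = A y" for x y
    using lower[of "x - y"] that z MD(5)[OF that(1,2)]
    by (simp add: bounded_op_diff[OF M A] mult_le_0_iff)
  obtain S where SM: "\<And>x. x \<in> M \<Longrightarrow> S x \<in> M" and AS: "\<And>x. x \<in> M \<Longrightarrow> A (S x) = x"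
    using surj by metis
  note AD = bounded_opD[OF A]
  have "bounded_op M S"
    unfolding bounded_op_def
  proof (intro conjI ballI allI exI[of _ "1 / (cmod z - 1)"])
    fix x y assume "x \<in> M" "y \<in> M"
    then show "S (x + y) = S x + S y" by - (rule inj, auto simp: SM MD AS AD)
  next
    fix c x assume "x \<in> M"
    then show "S (c *\<^sub>C x) = c *\<^sub>C S x" by - (rule inj, auto simp: SM MD AS AD)
  next
    fix x assume "x \<in> M"
    then show "norm (S x) \<le> 1 / (cmod z - 1) * norm x"
      using lower[of "S x"] z by (simp add: SM AS pos_le_divide_eq mult.commute)
  qed (rule SM)
  moreover have "S (A x) = x" if "x \<in> M" for x
    using that by - (rule inj, auto simp: SM AS AD)
  ultimately show ?thesis
    unfolding invertible_op_def A_def[symmetric] using A AS by blast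
qed

text \<open>Both claims follow by splitting off one root of \<open>q\<close>, necessarily outside
  the disk, so one induction serves them. Surjectivity makes the \<open>inv_into\<close> of
  \<open>rat_op\<close> a genuine preimage; the polynomial approximation of 1/q reduces quotients to
  the polynomial inequality.\<close>

lemma poly_op_surj_inverse_approx:
  assumes "q \<noteq> 0" "\<And>z. cmod z \<le> 1 \<Longrightarrow> poly q z \<noteq> 0"
  shows "(\<forall>x\<in>M. \<exists>y\<in>M. poly_op q T y = x) \<and>
    (\<forall>\<epsilon>>0. \<exists>s. \<forall>z. cmod z \<le> 1 \<longrightarrow> cmod (1 - poly q z * poly s z) \<le> \<epsilon>)"
  using assms
proof (induction "degree q" arbitrary: q)
  case 0
  then obtain c where q: "q = [:c:]" "c \<noteq> 0" by (metis degree_eq_zeroE pCons_0_0)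
  have "\<exists>y\<in>M. poly_op q T y = x" if "x \<in> M" for x
    using that q by (intro bexI[of _ "inverse c *\<^sub>C x"])
      (auto simp: poly_op_def scaleC_scaleC MD)
  moreover have "cmod (1 - poly q z * poly [:inverse c:] z) \<le> \<epsilon>" if "\<epsilon> > 0" for \<epsilon> z
    using that q by simp
  ultimately show ?case by blast
next
  case (Suc n)
  obtain \<zeta> where "poly q \<zeta> = 0"
    using fundamental_theorem_of_algebra[of q] Suc.hyps(2) by (auto simp: constant_degree)
  then obtain q' where q: "q = [:- \<zeta>, 1:] * q'"
    by (metis dvdE poly_eq_0_iff_dvd)
  have q'0: "q' \<noteq> 0" using Suc.prems(1) q by auto
  have "degree q = 1 + degree q'" unfolding q using q'0 by (subst degree_mult_eq) auto
  then have dq': "n = degree q'" using Suc.hyps(2) by simp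
  have \<zeta>: "cmod \<zeta> > 1" using Suc.prems(2)[of \<zeta>] q by force
  then have "\<zeta> \<noteq> 0" by auto
  have q'nz: "poly q' z \<noteq> 0" if "cmod z \<le> 1" for z using Suc.prems(2)[OF that] q by auto
  note IH = Suc.hyps(1)[OF dq' q'0 q'nz]
  have "\<exists>y\<in>M. poly_op q T y = x" if x: "x \<in> M" for x
  proof -
    obtain S where S: "\<And>x. x \<in> M \<Longrightarrow> S x \<in> M" "\<And>x. x \<in> M \<Longrightarrow> \<zeta> *\<^sub>C S x - T (S x) = x"
      using invertible_outside_disk[OF \<zeta>] unfolding invertible_op_def by (metis bounded_opD(1))
    have x': "- x \<in> M" using MD(6)[OF x, of "-1"] by simp
    obtain y where y: "y \<in> M" "poly_op q' T y = S (- x)"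
      using IH S(1)[OF x'] by blast
    have "poly_op q T y = poly_op [:- \<zeta>, 1:] T (S (- x))"
      unfolding q y(2)[symmetric] using y(1) by (rule poly_op_mult)
    also have "\<dots> = - (\<zeta> *\<^sub>C S (- x) - T (S (- x)))"
      using S(1)[OF x'] by (simp add: poly_op_linear)
    finally show ?thesis
      using y(1) S(2)[OF x'] by auto
  qed
  moreover have "\<exists>s. \<forall>z. cmod z \<le> 1 \<longrightarrow> cmod (1 - poly q z * poly s z) \<le> \<epsilon>" if \<epsilon>: "\<epsilon> > 0" for \<epsilon>
  proof -
    \<comment> \<open>If two factors are within \<open>\<eta> \<le> 1\<close> of 1, their product is
      within \<open>2 * \<eta> + \<eta>\<^sup>2 \<le> 3 * \<eta>\<close>.\<close>
    define \<eta> where "\<eta> = min 1 (\<epsilon> / 3)"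
    have \<eta>: "\<eta> > 0" "\<eta> \<le> 1" "3 * \<eta> \<le> \<epsilon>" using \<epsilon> by (auto simp: \<eta>_def)
    obtain s where s: "\<And>z. cmod z \<le> 1 \<Longrightarrow> cmod (1 - poly q' z * poly s z) \<le> \<eta>"
      using IH \<eta>(1) by blast
    obtain m where m: "inverse (cmod \<zeta>) ^ m < \<eta>"
      using real_arch_pow_inv[OF \<eta>(1), of "inverse (cmod \<zeta>)"] \<zeta> by (auto simp: inverse_less_1_iff)
    \<comment> \<open>Truncated geometric series: \<open>t\<close> approximates 1 / (z - \<zeta>) on
      the disk with relative error (z / \<zeta>)^m.\<close>
    define g where "g = (\<Sum>k<m. monom (inverse \<zeta> ^ k) k)"
    define t where "t = smult (- inverse \<zeta>) g"
    have geom: "1 - (z - \<zeta>) * poly t z = (inverse \<zeta> * z) ^ m" for z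
    proof -
      have "poly g z = (\<Sum>k<m. (inverse \<zeta> * z) ^ k)"
        by (simp add: g_def poly_sum poly_monom power_mult_distrib)
      then have "(1 - inverse \<zeta> * z) * poly g z = 1 - (inverse \<zeta> * z) ^ m"
        by (simp add: one_diff_power_eq)
      moreover have "(z - \<zeta>) * poly t z = (1 - inverse \<zeta> * z) * poly g z"
        using \<open>\<zeta> \<noteq> 0\<close> by (simp add: t_def field_simps)
      ultimately show ?thesis by simp
    qed
    have "cmod (1 - poly q z * poly (t * s) z) \<le> \<epsilon>" if z: "cmod z \<le> 1" for z
    proof -
      define a where "a = (z - \<zeta>) * poly t z"
      define b where "b = poly q' z * poly s z"
      have "cmod (1 - a) = (inverse (cmod \<zeta>) * cmod z) ^ m"
        unfolding a_def geom by (simp add: norm_power norm_mult norm_inverse)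
      also have "\<dots> \<le> inverse (cmod \<zeta>) ^ m"
        using z by (intro power_mono mult_left_le) auto
      finally have a: "cmod (1 - a) \<le> \<eta>" using m by linarith
      have b: "cmod (1 - b) \<le> \<eta>" using s[OF z] by (simp add: b_def)
      have "1 - a * b = (1 - a) + (1 - b) - (1 - a) * (1 - b)" by (simp add: algebra_simps)
      then have "cmod (1 - a * b) \<le> cmod (1 - a) + cmod (1 - b) + cmod (1 - a) * cmod (1 - b)"
        using norm_triangle_ineq4[of "(1 - a) + (1 - b)" "(1 - a) * (1 - b)"]
          norm_triangle_ineq[of "1 - a" "1 - b"] by (simp only: norm_mult)
      also have "\<dots> \<le> \<eta> + \<eta> + \<eta> * 1"
        using a b \<eta> by (intro add_mono mult_mono) auto
      also have "\<dots> \<le> \<epsilon>" using \<eta> by simp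
      finally have "cmod (1 - a * b) \<le> \<epsilon>" .
      also have "a * b = poly q z * poly (t * s) z"
        by (simp add: a_def b_def q algebra_simps)
      finally show ?thesis .
    qed
    then show ?thesis by blast
  qed
  ultimately show ?case by blast
qed

text \<open>With x = q(T) y and a polynomial \<open>s\<close> close to 1/q, the vector p(T) y splits
  into (p (1 - q s))(T) y, which is small, and (p s)(T) x, bounded by almost \<open>C\<close> times
  the norm of \<open>x\<close>. This works for whichever preimage \<open>y\<close> the
  \<open>inv_into\<close> picks.\<close>

lemma von_Neumann_rational:
  assumes q: "q \<noteq> 0" "\<And>z. cmod z \<le> 1 \<Longrightarrow> poly q z \<noteq> 0"
    and C: "\<And>z. cmod z \<le> 1 \<Longrightarrow> cmod (poly p z / poly q z) \<le> C" and x: "x \<in> M"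
  shows "norm (rat_op M p q T x) \<le> C * norm x"
proof -
  define y where "y = inv_into M (poly_op q T) x"
  have "x \<in> poly_op q T ` M"
    using poly_op_surj_inverse_approx[OF q] x by (auto intro: rev_image_eqI)
  then have y: "y \<in> M" "poly_op q T y = x"
    unfolding y_def by (auto intro: inv_into_into f_inv_into_f)
  have C0: "C \<ge> 0" using order_trans[OF norm_ge_zero C[of 0]] by simp
  have "compact (cball (0::complex) 1)" by simp
  then have "bounded (poly p ` cball 0 1)"
    by (intro compact_imp_bounded compact_continuous_image continuous_intros)
  then obtain B where B: "B > 0" "\<And>z. cmod z \<le> 1 \<Longrightarrow> cmod (poly p z) \<le> B"
    unfolding bounded_pos by auto
  have eps: "norm (poly_op p T y) \<le> C * norm x + \<epsilon> * (B * norm y + C * norm x)" if \<epsilon>: "\<epsilon> > 0" for \<epsilon>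
  proof -
    obtain s where s: "\<And>z. cmod z \<le> 1 \<Longrightarrow> cmod (1 - poly q z * poly s z) \<le> \<epsilon>"
      using poly_op_surj_inverse_approx[OF q] \<epsilon> by blast
    have "poly_op p T y = poly_op (p * (1 - q * s)) T y + poly_op (p * s) T x"
      using y(1) by (simp flip: y(2) poly_op_mult poly_op_add) (simp add: algebra_simps)
    moreover have "norm (poly_op (p * (1 - q * s)) T y) \<le> (B * \<epsilon>) * norm y"
      using B s by (intro von_Neumann_poly y) (auto simp: norm_mult intro!: mult_mono)
    moreover have "norm (poly_op (p * s) T x) \<le> (C * (1 + \<epsilon>)) * norm x"
    proof (intro von_Neumann_poly x)
      fix z :: complex assume z: "cmod z \<le> 1"
      have "cmod (poly (p * s) z) = cmod (poly p z / poly q z) * cmod (poly q z * poly s z)"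
        using q(2)[OF z] by (simp add: norm_mult norm_divide)
      also have "\<dots> \<le> C * (1 + \<epsilon>)"
        using C[OF z] C0 s[OF z] norm_triangle_ineq4[of 1 "1 - poly q z * poly s z"]
        by (intro mult_mono) auto
      finally show "cmod (poly (p * s) z) \<le> C * (1 + \<epsilon>)" .
    qed
    ultimately show ?thesis
      using norm_triangle_ineq[of "poly_op (p * (1 - q * s)) T y" "poly_op (p * s) T x"]
      by (simp add: algebra_simps)
  qed
  define D where "D = B * norm y + C * norm x"
  have "D \<ge> 0" using B(1) C0 by (simp add: D_def)
  have "norm (poly_op p T y) \<le> C * norm x"
  proof (rule field_le_epsilon)
    fix e :: real assume "e > 0"
    then have "e / (D + 1) * D \<le> e" "e / (D + 1) > 0"
      using \<open>D \<ge> 0\<close> by (auto simp: field_simps)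
    then show "norm (poly_op p T y) \<le> C * norm x + e"
      using eps[of "e / (D + 1)"] unfolding D_def[symmetric] by linarith
  qed
  then show ?thesis by (simp add: rat_op_def y_def)
qed

lemma spectral_set_disk: "spectral_set (cball 0 1) M T"
  unfolding spectral_set_def
proof (intro conjI ballI)
  show "spectrum_op M T \<subseteq> cball 0 1"
    using invertible_outside_disk by (force simp: spectrum_op_def not_le[symmetric])
next
  fix f :: "complex poly \<times> complex poly" assume "f \<in> Rat (cball 0 1)"
  then obtain p q where f: "f = (p, q)" and q: "q \<noteq> 0" "\<And>z. cmod z \<le> 1 \<Longrightarrow> poly q z \<noteq> 0"
    by (auto simp: Rat_def)
  define C where "C = Sup (insert 0 ((\<lambda>z. cmod (poly p z / poly q z)) ` cball 0 1))"
  have "compact ((\<lambda>z. cmod (poly p z / poly q z)) ` cball 0 1)"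
    using q(2) by (intro compact_continuous_image continuous_intros) auto
  then have bdd: "bdd_above (insert 0 ((\<lambda>z. cmod (poly p z / poly q z)) ` cball 0 1))"
    by (simp add: compact_imp_bounded bounded_imp_bdd_above)
  have C: "cmod (poly p z / poly q z) \<le> C" if "cmod z \<le> 1" for z
    unfolding C_def using that by (intro cSup_upper[OF _ bdd]) auto
  have C0: "C \<ge> 0" unfolding C_def by (intro cSup_upper[OF _ bdd]) auto
  have "op_norm M (rat_op M p q T) \<le> C"
    unfolding op_norm_def
  proof (rule cSUP_least)
    show "{x \<in> M. norm x \<le> 1} \<noteq> {}" using MD(3) by (auto intro!: exI[of _ 0])
    fix x assume x: "x \<in> {x \<in> M. norm x \<le> 1}"
    then have "norm (rat_op M p q T x) \<le> C * norm x"
      by (intro von_Neumann_rational q C) auto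
    also have "\<dots> \<le> C" using x C0 by (simp add: mult_left_le)
    finally show "norm (rat_op M p q T x) \<le> C" .
  qed
  then show "case f of (p, q) \<Rightarrow> op_norm M (rat_op M p q T)
      \<le> Sup (insert 0 ((\<lambda>z. cmod (poly p z / poly q z)) ` cball 0 1))"
    by (simp add: f C_def)
qed

end

section \<open>Orthonormal sequences and weighted shifts\<close>

text \<open>Gram-Schmidt by dependent choice: a vector outside the span of finitely many always
  exists, and its component orthogonal to the earlier ones is normalised.\<close>

lemma orthonormal_sequence_exists:
  assumes inf: "\<not> (\<exists>B. finite B \<and> span B = (UNIV :: 'a::complex_hilbert set))"
  obtains e :: "nat \<Rightarrow> 'a::complex_hilbert" where "\<And>m n. cinner (e m) (e n) = (if m = n then 1 else 0)"
proof -
  define P where "P f n v \<longleftrightarrow> norm v = 1 \<and> (\<forall>m<n. cinner v (f m) = 0)" for f :: "nat \<Rightarrow> 'a" and n v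
  have "\<exists>f. \<forall>n. P f n (f n)"
  proof (rule dependent_wellorder_choice)
    show "P f n v = P g n v" if "\<And>m. m < n \<Longrightarrow> f m = g m" for v f g n
      using that by (auto simp: P_def)
  next
    fix n and f :: "nat \<Rightarrow> 'a" assume IH: "\<And>m. m < n \<Longrightarrow> P f m (f m)"
    have orth: "cinner (f i) (f j) = (if i = j then 1 else 0)" if "i < n" "j < n" for i j
    proof (cases i j rule: linorder_cases)
      case less
      then show ?thesis using IH[OF that(2)] cinner_commute[of "f i" "f j"] by (simp add: P_def)
    next
      case equal
      then show ?thesis using IH[OF that(1)] by (simp add: P_def cinner_self)
    next
      case greater
      then show ?thesis using IH[OF that(1)] by (simp add: P_def)
    qed
    \<comment> \<open>\<open>span\<close> is the real span; the multiples by \<open>\<i>\<close>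
      make it contain all complex combinations.\<close>
    define B where "B = f ` {..<n} \<union> (\<lambda>v. \<i> *\<^sub>C v) ` f ` {..<n}"
    have "finite B" by (simp add: B_def)
    then obtain u where u: "u \<notin> span B" using inf by blast
    have span: "c *\<^sub>C f m \<in> span B" if "m < n" for c m
    proof -
      have "c *\<^sub>C f m = (complex_of_real (Re c) + complex_of_real (Im c) * \<i>) *\<^sub>C f m"
        by (metis complex_eq mult.commute)
      also have "\<dots> = Re c *\<^sub>R f m + Im c *\<^sub>R (\<i> *\<^sub>C f m)"
        by (simp add: scaleR_scaleC scaleC_add_left scaleC_scaleC)
      also have "\<dots> \<in> span B"
        using that by (intro span_add span_scale span_base) (auto simp: B_def)
      finally show ?thesis .
    qed
    define w where "w = u - (\<Sum>m<n. cinner u (f m) *\<^sub>C f m)"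
    have "w \<noteq> 0"
    proof
      assume "w = 0"
      then have "u = (\<Sum>m<n. cinner u (f m) *\<^sub>C f m)" by (simp add: w_def)
      also have "\<dots> \<in> span B" using span by (intro span_sum) auto
      finally show False using u by simp
    qed
    have "cinner w (f m) = 0" if "m < n" for m
    proof -
      have "(\<Sum>i<n. cinner u (f i) * cinner (f i) (f m)) = (\<Sum>i<n. if i = m then cinner u (f m) else 0)"
        using orth that by (intro sum.cong) auto
      then show ?thesis
        using that by (simp add: w_def cinner_diff_left cinner_sum_left cinner_scaleC_left)
    qed
    then have "P f n ((1 / norm w) *\<^sub>R w)"
      using \<open>w \<noteq> 0\<close> by (simp add: P_def cinner_scaleR_left)
    then show "\<exists>v. P f n v" by blast
  qed
  then obtain e where e: "\<And>n. P e n (e n)" by blast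
  have "cinner (e m) (e n) = (if m = n then 1 else 0)" for m n
  proof (cases m n rule: linorder_cases)
    case less
    then show ?thesis using e[of n] cinner_commute[of "e m" "e n"] by (simp add: P_def)
  next
    case equal
    then show ?thesis using e[of m] by (simp add: P_def cinner_self)
  next
    case greater
    then show ?thesis using e[of m] by (simp add: P_def)
  qed
  then show ?thesis by (rule that)
qed

locale orthonormal_sequence =
  fixes e :: "nat \<Rightarrow> 'a::complex_hilbert"
  assumes orthonormal: "cinner (e m) (e n) = (if m = n then 1 else 0)"
begin

lemma norm_sum_sq:
  assumes "finite A"
  shows "(norm (\<Sum>n\<in>A. c n *\<^sub>C e n))\<^sup>2 = (\<Sum>n\<in>A. (cmod (c n))\<^sup>2)"
proof -
  have "complex_of_real ((norm (\<Sum>n\<in>A. c n *\<^sub>C e n))\<^sup>2) =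
      (\<Sum>m\<in>A. \<Sum>n\<in>A. if m = n then c m * cnj (c m) else 0)"
    unfolding cinner_self[symmetric] cinner_sum_left
    by (auto simp: cinner_sum_right cinner_scaleC_left cinner_scaleC_right orthonormal
        intro!: sum.cong)
  also have "\<dots> = complex_of_real (\<Sum>n\<in>A. (cmod (c n))\<^sup>2)"
    using assms by (simp add: complex_norm_square del: of_real_power)
  finally show ?thesis by (simp only: of_real_eq_iff)
qed

lemma Riesz_Fischer:
  assumes "summable (\<lambda>n. (cmod (c n))\<^sup>2)"
  shows "summable (\<lambda>n. c n *\<^sub>C e n)"
  unfolding summable_Cauchy
proof (intro allI impI)
  fix \<epsilon> :: real assume \<epsilon>: "\<epsilon> > 0"
  then obtain N where N: "\<And>m n. m \<ge> N \<Longrightarrow> norm (\<Sum>k\<in>{m..<n}. (cmod (c k))\<^sup>2) < \<epsilon>\<^sup>2"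
    using assms unfolding summable_Cauchy by (meson zero_less_power)
  have "norm (\<Sum>k\<in>{m..<n}. c k *\<^sub>C e k) < \<epsilon>" if "m \<ge> N" for m n
  proof (rule power2_less_imp_less)
    show "(norm (\<Sum>k\<in>{m..<n}. c k *\<^sub>C e k))\<^sup>2 < \<epsilon>\<^sup>2"
      using N[OF that, of n] by (simp add: norm_sum_sq sum_nonneg)
  qed (use \<epsilon> in simp)
  then show "\<exists>N. \<forall>m\<ge>N. \<forall>n. norm (\<Sum>k\<in>{m..<n}. c k *\<^sub>C e k) < \<epsilon>" by blast
qed

lemma sums_norm_sq:
  assumes "(\<lambda>n. c n *\<^sub>C e n) sums x"
  shows "(\<lambda>n. (cmod (c n))\<^sup>2) sums (norm x)\<^sup>2"
proof -
  have "(\<lambda>N. (norm (\<Sum>n<N. c n *\<^sub>C e n))\<^sup>2) \<longlonglongrightarrow> (norm x)\<^sup>2"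
    using assms unfolding sums_def by (intro tendsto_intros)
  then show ?thesis by (simp add: norm_sum_sq sums_def)
qed

lemma sums_coeff:
  assumes "(\<lambda>n. c n *\<^sub>C e n) sums x"
  shows "cinner x (e n) = c n"
proof -
  have "(\<lambda>m. cinner (c m *\<^sub>C e m) (e n)) sums cinner x (e n)"
    by (rule bounded_linear.sums[OF bounded_linear_cinner_left assms])
  moreover have "(\<lambda>m. cinner (c m *\<^sub>C e m) (e n)) = (\<lambda>m. if m = n then c m else 0)"
    by (auto simp: cinner_scaleC_left orthonormal)
  ultimately show ?thesis
    using sums_single[of n c] sums_unique2 by metis
qed

lemma Bessel: "(\<Sum>n<N. (cmod (cinner x (e n)))\<^sup>2) \<le> (norm x)\<^sup>2"
proof -
  define y where "y = (\<Sum>n<N. cinner x (e n) *\<^sub>C e n)"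
  have "cinner x y = complex_of_real (\<Sum>n<N. (cmod (cinner x (e n)))\<^sup>2)"
    by (simp add: y_def cinner_sum_right cinner_scaleC_right complex_norm_square mult.commute
        del: of_real_power)
  moreover have "(norm y)\<^sup>2 = (\<Sum>n<N. (cmod (cinner x (e n)))\<^sup>2)"
    by (simp add: y_def norm_sum_sq)
  ultimately have "(norm (x - y))\<^sup>2 = (norm x)\<^sup>2 - (\<Sum>n<N. (cmod (cinner x (e n)))\<^sup>2)"
    unfolding norm_diff_sq by simp
  then show ?thesis by (metis diff_ge_0_iff_ge zero_le_power2)
qed

lemma summable_coeffs: "summable (\<lambda>n. (cmod (cinner x (e n)))\<^sup>2)"
  by (rule summableI_nonneg_bounded[of _ "(norm x)\<^sup>2"]) (auto intro: Bessel)

text \<open>The closed linear span of the sequence, as its double orthogonal complement.\<close>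

definition closed_span :: "'a set" where
  "closed_span = {x. \<forall>z. (\<forall>n. cinner (e n) z = 0) \<longrightarrow> cinner x z = 0}"

lemma e_in_closed_span [simp]: "e n \<in> closed_span"
  by (simp add: closed_span_def)

lemma closed_csubspace_closed_span: "closed_csubspace closed_span"
  unfolding closed_csubspace_def
proof (intro conjI)
  have "closed_span = (\<Inter>z\<in>{z. \<forall>n. cinner (e n) z = 0}. {x. cinner x z = 0})"
    by (auto simp: closed_span_def)
  moreover have "closed {x. cinner x z = 0}" for z :: 'a
    by (intro closed_Collect_eq continuous_intros
        linear_continuous_on[OF bounded_linear_cinner_left])
  ultimately show "closed closed_span" by auto
qed (auto simp: closed_span_def subspace_def cinner_add_left cinner_scaleR_left cinner_scaleC_left)

text \<open>The series converges to some \<open>y\<close>, and x - y is orthogonal to every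
  \<open>e n\<close>. Membership in the double complement makes it orthogonal to \<open>x\<close>,
  termwise evaluation to \<open>y\<close>; so it is orthogonal to itself.\<close>

lemma closed_span_expansion:
  assumes "x \<in> closed_span"
  shows "(\<lambda>n. cinner x (e n) *\<^sub>C e n) sums x"
proof -
  obtain y where y: "(\<lambda>n. cinner x (e n) *\<^sub>C e n) sums y"
    using Riesz_Fischer[OF summable_coeffs] summable_def by blast
  define z where "z = x - y"
  have z: "cinner (e n) z = 0" for n
    using sums_coeff[OF y, of n] cinner_commute[of "e n" z] by (simp add: z_def cinner_diff_left)
  have "cinner x z = 0" using assms z by (simp add: closed_span_def)
  moreover have "(\<lambda>n. cinner (cinner x (e n) *\<^sub>C e n) z) sums cinner y z"
    by (rule bounded_linear.sums[OF bounded_linear_cinner_left y])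
  then have "cinner y z = 0"
    using z sums_unique2[OF _ sums_zero] by (auto simp: cinner_scaleC_left)
  ultimately have "cinner z z = 0" by (simp add: z_def cinner_diff_left)
  then have "x = y" by (simp add: z_def cinner_self)
  then show ?thesis using y by simp
qed

text \<open>Leaving the index map arbitrary lets one construction supply the shift, its inverse and
  their composites, with natural numbers coding a bilateral index.\<close>

definition weighted_shift :: "(nat \<Rightarrow> real) \<Rightarrow> (nat \<Rightarrow> nat) \<Rightarrow> 'a \<Rightarrow> 'a" where
  "weighted_shift w \<tau> x = (\<Sum>n. (of_real (w n) * cinner x (e n)) *\<^sub>C e (\<tau> n))"

context
  fixes w :: "nat \<Rightarrow> real" and K :: real and \<tau> :: "nat \<Rightarrow> nat"
  assumes w: "\<forall>n. \<bar>w n\<bar> \<le> K" and \<tau>: "inj \<tau>"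
begin

lemma orthonormal_comp: "orthonormal_sequence (\<lambda>n. e (\<tau> n))"
  using \<tau> by unfold_locales (auto simp: orthonormal inj_eq)

interpretation e\<tau>: orthonormal_sequence "\<lambda>n. e (\<tau> n)"
  by (rule orthonormal_comp)

lemma weighted_term_bound: "(w n)\<^sup>2 * (cmod (cinner x (e n)))\<^sup>2 \<le> K\<^sup>2 * (cmod (cinner x (e n)))\<^sup>2"
  using power_mono[OF w[rule_format, of n], of 2] by (intro mult_right_mono) auto

lemma weighted_shift_sums:
  "(\<lambda>n. (of_real (w n) * cinner x (e n)) *\<^sub>C e (\<tau> n)) sums weighted_shift w \<tau> x"
  unfolding weighted_shift_def
proof (intro summable_sums e\<tau>.Riesz_Fischer)
  have "summable (\<lambda>n. K\<^sup>2 * (cmod (cinner x (e n)))\<^sup>2)"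
    by (intro summable_mult summable_coeffs)
  then show "summable (\<lambda>n. (cmod (of_real (w n) * cinner x (e n)))\<^sup>2)"
    by (rule summable_comparison_test')
      (use weighted_term_bound in \<open>auto simp: norm_mult power_mult_distrib\<close>)
qed

lemma weighted_shift_norm_sums:
  "(\<lambda>n. (w n)\<^sup>2 * (cmod (cinner x (e n)))\<^sup>2) sums (norm (weighted_shift w \<tau> x))\<^sup>2"
  using e\<tau>.sums_norm_sq[OF weighted_shift_sums] by (simp add: norm_mult power_mult_distrib)

lemma weighted_shift_norm_le: "norm (weighted_shift w \<tau> x) \<le> K * norm x"
proof (rule power2_le_imp_le)
  show "0 \<le> K * norm x" using w[rule_format, of 0] by (intro mult_nonneg_nonneg) auto
  show "(norm (weighted_shift w \<tau> x))\<^sup>2 \<le> (K * norm x)\<^sup>2"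
  proof (rule LIMSEQ_le_const2[OF weighted_shift_norm_sums[unfolded sums_def]], intro exI allI impI)
    fix N
    have "(\<Sum>n<N. (w n)\<^sup>2 * (cmod (cinner x (e n)))\<^sup>2) \<le> (\<Sum>n<N. K\<^sup>2 * (cmod (cinner x (e n)))\<^sup>2)"
      by (intro sum_mono weighted_term_bound)
    also have "\<dots> \<le> K\<^sup>2 * (norm x)\<^sup>2"
      by (auto simp flip: sum_distrib_left intro!: mult_left_mono Bessel)
    finally show "(\<Sum>n<N. (w n)\<^sup>2 * (cmod (cinner x (e n)))\<^sup>2) \<le> (K * norm x)\<^sup>2"
      by (simp add: power_mult_distrib)
  qed
qed

lemma weighted_shift_add:
  "weighted_shift w \<tau> (x + y) = weighted_shift w \<tau> x + weighted_shift w \<tau> y"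
  using sums_add[OF weighted_shift_sums[of x] weighted_shift_sums[of y]] weighted_shift_sums[of "x + y"]
  by (intro sums_unique2) (auto simp: cinner_add_left distrib_left scaleC_add_left)

lemma weighted_shift_scaleC: "weighted_shift w \<tau> (c *\<^sub>C x) = c *\<^sub>C weighted_shift w \<tau> x"
  using bounded_linear.sums[OF bounded_linear_scaleC weighted_shift_sums[of x], of c]
    weighted_shift_sums[of "c *\<^sub>C x"]
  by (intro sums_unique2) (auto simp: cinner_scaleC_left scaleC_scaleC mult_ac)

lemma bounded_linear_weighted_shift: "bounded_linear (weighted_shift w \<tau>)"
  by (rule bounded_linear_intro[where K = K])
    (auto simp: weighted_shift_add scaleR_scaleC weighted_shift_scaleC mult.commute
      intro: order_trans[OF weighted_shift_norm_le])

lemma weighted_shift_closed: "weighted_shift w \<tau> x \<in> closed_span"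
proof (rule closed_sequentially)
  show "closed closed_span" by (rule closed_csubspaceD[OF closed_csubspace_closed_span])
  show "(\<lambda>N. \<Sum>n<N. (of_real (w n) * cinner x (e n)) *\<^sub>C e (\<tau> n)) \<longlonglongrightarrow> weighted_shift w \<tau> x"
    using weighted_shift_sums by (simp add: sums_def)
qed (intro closed_csubspaceD(6,8)[OF closed_csubspace_closed_span] e_in_closed_span)

lemma bounded_op_weighted_shift: "bounded_op closed_span (weighted_shift w \<tau>)"
  unfolding bounded_op_def
  using weighted_shift_closed weighted_shift_add weighted_shift_scaleC weighted_shift_norm_le by blast

lemma weighted_shift_basis: "weighted_shift w \<tau> (e n) = of_real (w n) *\<^sub>C e (\<tau> n)"
proof -
  have "(\<lambda>m. (of_real (w m) * cinner (e n) (e m)) *\<^sub>C e (\<tau> m)) =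
      (\<lambda>m. if m = n then of_real (w m) *\<^sub>C e (\<tau> m) else 0)"
    by (auto simp: orthonormal)
  then show ?thesis
    using weighted_shift_sums[of "e n"] sums_single[of n "\<lambda>m. of_real (w m) *\<^sub>C e (\<tau> m)"]
      sums_unique2 by metis
qed

end

text \<open>Weights multiply along the path of an index. This reduces the square of the shift, and
  the check that its inverse is one, to identities between weights.\<close>

lemma weighted_shift_comp:
  assumes w: "\<forall>n. \<bar>w n\<bar> \<le> K" "inj \<tau>" and v: "\<forall>n. \<bar>v n\<bar> \<le> L" "inj \<sigma>"
  shows "weighted_shift v \<sigma> (weighted_shift w \<tau> x) =
    weighted_shift (\<lambda>n. v (\<tau> n) * w n) (\<lambda>n. \<sigma> (\<tau> n)) x"
proof -
  have "(\<lambda>n. weighted_shift v \<sigma> ((of_real (w n) * cinner x (e n)) *\<^sub>C e (\<tau> n))) sums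
      weighted_shift v \<sigma> (weighted_shift w \<tau> x)"
    by (rule bounded_linear.sums[OF bounded_linear_weighted_shift[OF v] weighted_shift_sums[OF w]])
  then have "(\<lambda>n. (of_real (v (\<tau> n) * w n) * cinner x (e n)) *\<^sub>C e (\<sigma> (\<tau> n))) sums
      weighted_shift v \<sigma> (weighted_shift w \<tau> x)"
    by (simp add: weighted_shift_scaleC[OF v] weighted_shift_basis[OF v] scaleC_scaleC mult_ac)
  then show ?thesis
    unfolding weighted_shift_def[of "\<lambda>n. v (\<tau> n) * w n"] by (rule sums_unique)
qed

lemma weighted_shift_id:
  assumes "x \<in> closed_span"
  shows "weighted_shift (\<lambda>n. 1) (\<lambda>n. n) x = x"
  using closed_span_expansion[OF assms] by (simp add: weighted_shift_def sums_iff)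

end

text \<open>
  The bilateral shift with weights \<open>1\<close> on negative and \<open>r\<close> on nonnegative indices. Starting \<open>N\<close>
  steps to the left of the origin, the first \<open>N\<close> steps are isometric; \<open>i - N\<close> is truncated.
\<close>

lemma C_alpha_shift_exists:
  assumes r: "0 < r" "r < 1"
    and inf: "\<not> (\<exists>B. finite B \<and> span B = (UNIV :: 'a::complex_hilbert set))"
  obtains M :: "'a::complex_hilbert set" and T where "(M, T) \<in> C_alpha r"
    "\<And>N. \<exists>g\<in>M. \<forall>i j. cinner ((T ^^ i) g) ((T ^^ j) g) =
      (if i = j then of_real (r ^ (2 * (i - N))) else 0)"
proof -
  obtain e :: "nat \<Rightarrow> 'a" where "\<And>m n. cinner (e m) (e n) = (if m = n then 1 else 0)"
    using orthonormal_sequence_exists[OF inf] by blast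
  then interpret orthonormal_sequence e by unfold_locales
  define \<sigma> where "\<sigma> n = int_encode (int_decode n + 1)" for n
  define \<sigma>' where "\<sigma>' n = int_encode (int_decode n - 1)" for n
  have \<sigma>\<sigma>' [simp]: "\<sigma> (\<sigma>' n) = n" "\<sigma>' (\<sigma> n) = n" for n by (auto simp: \<sigma>_def \<sigma>'_def)
  have inj: "inj \<sigma>" "inj \<sigma>'" by (metis injI \<sigma>\<sigma>')+
  define w where "w n = (if int_decode n < 0 then 1 else r)" for n
  have w0: "w n \<noteq> 0" for n using r by (simp add: w_def)
  have w: "\<forall>n. \<bar>w n\<bar> \<le> 1" using r by (simp add: w_def)
  \<comment> \<open>The inverse undoes the weight of the step that arrives at \<open>n\<close>,
    which started at \<open>\<sigma>' n\<close>.\<close>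
  define w' where "w' n = 1 / w (\<sigma>' n)" for n
  have w': "\<forall>n. \<bar>w' n\<bar> \<le> 1 / r" using r by (simp add: w'_def w_def field_simps)
  define T where "T = weighted_shift w \<sigma>"
  define S where "S = weighted_shift w' \<sigma>'"
  note W = w inj(1) and W' = w' inj(2)
  have "(\<lambda>n. \<sigma>' (\<sigma> n)) = (\<lambda>n. n)" "(\<lambda>n. \<sigma> (\<sigma>' n)) = (\<lambda>n. n)" by simp_all
  then have "S (T x) = x" "T (S x) = x" if "x \<in> closed_span" for x
    using that w0 by (simp_all add: S_def T_def weighted_shift_comp[OF W W']
        weighted_shift_comp[OF W' W] weighted_shift_id w'_def)
  then have inv: "invertible_op closed_span T"
    unfolding invertible_op_def
    using bounded_op_weighted_shift[OF W] bounded_op_weighted_shift[OF W'] T_def S_def by blast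
  have "(norm (T (T x)))\<^sup>2 + r\<^sup>2 * (norm x)\<^sup>2 \<le> (1 + r\<^sup>2) * (norm (T x))\<^sup>2"
    if x: "x \<in> closed_span" for x
  proof (rule sums_le)
    let ?c = "\<lambda>n. (cmod (cinner x (e n)))\<^sup>2"
    have ww: "\<forall>n. \<bar>w (\<sigma> n) * w n\<bar> \<le> 1"
      using r by (auto simp: w_def abs_mult mult_le_one)
    have "inj (\<lambda>n. \<sigma> (\<sigma> n))" using inj(1) by (simp add: inj_def)
    then show "(\<lambda>n. (w (\<sigma> n) * w n)\<^sup>2 * ?c n + r\<^sup>2 * ?c n) sums
        ((norm (T (T x)))\<^sup>2 + r\<^sup>2 * (norm x)\<^sup>2)"
      unfolding T_def weighted_shift_comp[OF W W]
      by (intro sums_add sums_mult weighted_shift_norm_sums[OF ww]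
          sums_norm_sq[OF closed_span_expansion[OF x]])
    show "(\<lambda>n. (1 + r\<^sup>2) * ((w n)\<^sup>2 * ?c n)) sums ((1 + r\<^sup>2) * (norm (T x))\<^sup>2)"
      unfolding T_def by (intro sums_mult weighted_shift_norm_sums[OF W])
    \<comment> \<open>Origin of the weights: for a constant weight w the two sides differ by (w^2 -
      1)(w^2 - r^2), so 1 and r give equality. The only strict case is the index -1, where the
      weight drops from 1 to r and the claim is 2 r^2 \<le> 1 + r^2.\<close>
    have "(w (\<sigma> n) * w n)\<^sup>2 + r\<^sup>2 \<le> (1 + r\<^sup>2) * (w n)\<^sup>2" for n
      using r by (auto simp: w_def \<sigma>_def power_mult_distrib algebra_simps power_le_one)
    then have "((w (\<sigma> n) * w n)\<^sup>2 + r\<^sup>2) * ?c n \<le> ((1 + r\<^sup>2) * (w n)\<^sup>2) * ?c n" for n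
      by (rule mult_right_mono) simp
    then show "(w (\<sigma> n) * w n)\<^sup>2 * ?c n + r\<^sup>2 * ?c n \<le> (1 + r\<^sup>2) * ((w n)\<^sup>2 * ?c n)" for n
      by (simp add: algebra_simps)
  qed
  then have "(closed_span, T) \<in> C_alpha r"
    by (simp add: C_alpha_iff inv closed_csubspace_closed_span)
  moreover have "\<exists>g\<in>closed_span. \<forall>i j. cinner ((T ^^ i) g) ((T ^^ j) g) =
      (if i = j then of_real (r ^ (2 * (i - N))) else 0)" for N
  proof (intro bexI[of _ "e (int_encode (- int N))"] allI)
    let ?g = "e (int_encode (- int N))"
    have pow: "(T ^^ i) ?g = of_real (r ^ (i - N)) *\<^sub>C e (int_encode (int i - int N))" for i
    proof (induction i)
      case (Suc i)
      have "of_real (r ^ (i - N)) * of_real (w (int_encode (int i - int N))) =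
          complex_of_real (r ^ (Suc i - N))"
        by (auto simp: w_def Suc_diff_le simp flip: power_Suc2)
      then show ?case
        using Suc unfolding T_def
        by (simp add: weighted_shift_scaleC[OF W] weighted_shift_basis[OF W] scaleC_scaleC \<sigma>_def
            algebra_simps del: of_real_power)
    qed simp
    show "cinner ((T ^^ i) ?g) ((T ^^ j) ?g) = (if i = j then of_real (r ^ (2 * (i - N))) else 0)"
      for i j
      unfolding pow
      by (auto simp: cinner_scaleC_left cinner_scaleC_right orthonormal int_encode_eq
          power_mult power2_eq_square simp flip: power_add mult_2)
  qed simp
  ultimately show ?thesis by (rule that)
qed

section \<open>Minimality\<close>

text \<open>For f = p / (z - a), substituting x = (T - a) y into ||f(T) x|| \<le> ||x|| removes the
  inverse. As \<open>a\<close> is outside \<open>X\<close>, it is also outside the spectrum, and T -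
  a is invertible.\<close>

lemma (in subspace_operator) spectral_set_norm_le:
  assumes X: "spectral_set X M T" and a: "a \<notin> X"
    and p: "\<And>z. z \<in> X \<Longrightarrow> cmod (poly p z) \<le> cmod (z - a)" and y: "y \<in> M"
  shows "norm (poly_op p T y) \<le> norm (poly_op [:- a, 1:] T y)"
proof -
  define q where "q = [:- a, 1:]"
  have qT: "poly_op q T x = - (a *\<^sub>C x - T x)" if "x \<in> M" for x
    using that by (simp add: q_def poly_op_linear)
  have "invertible_op M (\<lambda>x. a *\<^sub>C x - T x)"
    using X a by (auto simp: spectral_set_def spectrum_op_def)
  then obtain S where S: "bounded_op M S"
    and S1: "\<And>x. x \<in> M \<Longrightarrow> S (a *\<^sub>C x - T x) = x" and S2: "\<And>x. x \<in> M \<Longrightarrow> a *\<^sub>C S x - T (S x) = x"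
    unfolding invertible_op_def by blast
  have inj: "inj_on (poly_op q T) M"
    by (rule inj_onI) (metis S1 qT neg_equal_iff_equal)
  have rat: "rat_op M p q T (poly_op q T u) = poly_op p T u" if "u \<in> M" for u
    using inj that by (simp add: rat_op_def)
  obtain K where K: "K \<ge> 0" "\<And>x. x \<in> M \<Longrightarrow> norm (poly_op p T x) \<le> K * norm x"
    using bounded_op_norm_bound[OF bounded_op_poly_op] by blast
  obtain L where L: "\<And>x. x \<in> M \<Longrightarrow> norm (S x) \<le> L * norm x" "L \<ge> 0"
    using bounded_op_norm_bound[OF S] by blast
  \<comment> \<open>A real \<open>SUP\<close> dominates its members only if the set is bounded
    above, so f(T) must be seen to be bounded before \<open>op_norm\<close> gives an
    estimate.\<close>
  have bound: "norm (rat_op M p q T x) \<le> K * L" if x: "x \<in> M" "norm x \<le> 1" for x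
  proof -
    have x': "- x \<in> M" using MD(6)[OF x(1), of "-1"] by simp
    have Sx: "S (- x) \<in> M" using bounded_opD(1)[OF S x'] .
    have "poly_op q T (S (- x)) = x" using qT[OF Sx] S2[OF x'] by simp
    then have "norm (rat_op M p q T x) = norm (poly_op p T (S (- x)))"
      using rat[OF Sx] by simp
    also have "\<dots> \<le> K * (L * norm x)"
      using K(2)[OF Sx] mult_left_mono[OF L(1)[OF x'] K(1)] by simp
    also have "\<dots> \<le> K * L"
      using K(1) L(2) x(2) by (simp add: mult_left_le mult_left_mono)
    finally show ?thesis .
  qed
  have "(p, q) \<in> Rat X" using a by (auto simp: Rat_def q_def)
  then have "op_norm M (rat_op M p q T) \<le> Sup (insert 0 ((\<lambda>z. cmod (poly p z / poly q z)) ` X))"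
    using X by (auto simp: spectral_set_def)
  also have "\<dots> \<le> 1"
  proof (rule cSup_least)
    show "t \<le> 1" if "t \<in> insert 0 ((\<lambda>z. cmod (poly p z / poly q z)) ` X)" for t
      using that p a by (auto simp: q_def norm_divide divide_le_eq_1)
  qed simp
  finally have op: "op_norm M (rat_op M p q T) \<le> 1" .
  show ?thesis
  proof (cases "y = 0")
    case True
    then show ?thesis using bounded_op_zero[OF M bounded_op_poly_op] by simp
  next
    case False
    define n where "n = norm (poly_op q T y)"
    have "poly_op q T y \<noteq> 0"
      using inj_onD[OF inj, of y 0] False y MD(3) bounded_op_zero[OF M bounded_op_poly_op] by auto
    then have n: "n > 0" by (simp add: n_def)
    note lin = bounded_opD(3)[OF bounded_op_poly_op y]
    define u where "u = of_real (1 / n) *\<^sub>C y"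
    have u: "u \<in> M" "poly_op q T u \<in> M" using y by (auto simp: u_def MD poly_op_closed)
    have "norm (poly_op q T u) = 1" using n by (simp add: u_def lin n_def[symmetric] norm_divide)
    then have "norm (rat_op M p q T (poly_op q T u)) \<le> op_norm M (rat_op M p q T)"
      unfolding op_norm_def using u(2) bound by (intro cSUP_upper) (auto intro!: bdd_aboveI)
    then have "norm (poly_op p T u) \<le> 1" using op rat[OF u(1)] by simp
    then show ?thesis
      using n by (simp add: u_def lin divide_le_eq_1 norm_divide n_def q_def)
  qed
qed

section \<open>Estimates for the test function and its Laurent coefficients\<close>

lemma power_Bernoulli_le_one:
  assumes "0 \<le> u" "u \<le> (1::real)"
  shows "u ^ n * (1 + real n * (1 - u)) \<le> 1"
proof (induction n)
  case (Suc n)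
  \<comment> \<open>This is exactly the gap between the two sides of the next inequality.\<close>
  have "0 \<le> (real n + 1) * (1 - u)\<^sup>2" by simp
  then have "u * (1 + real (Suc n) * (1 - u)) \<le> 1 + real n * (1 - u)"
    by (simp add: algebra_simps power2_eq_square)
  from mult_left_mono[OF this, of "u ^ n"] Suc show ?case
    using assms by (simp add: mult_ac)
qed simp

text \<open>With u = |z|^2 and d = |z - a|^2, the identity |1 - cnj a z|^2 = d + (1 - u)(1 - |a|^2)
  shows that the excess over d fades towards the circle. Since N \<ge> 1 / \<epsilon>^2, it is at
  most d N (1 - u), and u^N absorbs the resulting factor 1 + N (1 - u).\<close>

lemma Blaschke_power_le:
  assumes z: "cmod z \<le> 1" and a: "cmod a \<le> 1" and \<epsilon>: "0 < \<epsilon>" "\<epsilon> \<le> cmod (z - a)"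
    and N: "1 \<le> real N * \<epsilon>\<^sup>2"
  shows "cmod (z ^ N * (1 - cnj a * z)) \<le> cmod (z - a)"
proof (rule power2_le_imp_le)
  define u where "u = (cmod z)\<^sup>2"
  define d where "d = (cmod (z - a))\<^sup>2"
  have u: "0 \<le> u" "u \<le> 1" using z by (auto simp: u_def power_le_one)
  have "\<epsilon>\<^sup>2 \<le> d" using \<epsilon> by (simp add: d_def power_mono)
  then have dN: "1 \<le> d * real N"
    using N mult_right_mono[of "\<epsilon>\<^sup>2" d "real N"] by (simp add: mult.commute)
  have "(cmod (1 - cnj a * z))\<^sup>2 = d + (1 - u) * (1 - (cmod a)\<^sup>2)"
    unfolding u_def d_def cmod_power2 by (simp add: algebra_simps power2_eq_square)
  also have "\<dots> \<le> d + (1 - u) * 1"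
    using u by (intro add_left_mono mult_left_mono) auto
  also have "\<dots> \<le> d + (1 - u) * (d * real N)"
    using u dN by (intro add_left_mono mult_left_mono) auto
  finally have "(cmod (1 - cnj a * z))\<^sup>2 \<le> d * (1 + real N * (1 - u))"
    by (simp add: algebra_simps)
  then have "u ^ N * (cmod (1 - cnj a * z))\<^sup>2 \<le> u ^ N * (d * (1 + real N * (1 - u)))"
    using u by (intro mult_left_mono) auto
  also have "\<dots> = d * (u ^ N * (1 + real N * (1 - u)))" by simp
  also have "\<dots> \<le> d * 1"
    using power_Bernoulli_le_one[OF u, of N] by (intro mult_left_mono) (auto simp: d_def)
  finally show "(cmod (z ^ N * (1 - cnj a * z)))\<^sup>2 \<le> (cmod (z - a))\<^sup>2"
    by (simp add: norm_mult norm_power power_mult_distrib u_def d_def power_mult[symmetric] mult.commute)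
qed simp

lemma sum_lessThan_add:
  fixes f :: "nat \<Rightarrow> 'a::comm_monoid_add"
  shows "(\<Sum>k<m + n. f k) = (\<Sum>k<m. f k) + (\<Sum>k<n. f (m + k))"
  by (induction n) (auto simp: add_ac)

text \<open>By truncated subtraction the first \<open>N\<close> denominators are 1; the others are
  at most \<open>r\<^sup>2\<close>. So the right side is at least (1 - t^N)(1 + t^N / r^2), which
  exceeds 1 exactly when t^N < 1 - r^2.\<close>

lemma weighted_geometric_sum_gt:
  fixes t r :: real
  assumes t: "0 < t" "t < 1" and r: "0 < r" "r < 1" and N: "t ^ N < 1 - r\<^sup>2"
  shows "1 < (1 - t) * (\<Sum>k<N + N. t ^ k / r ^ (2 * (Suc k - N)))"
proof -
  have geom: "(1 - t) * (\<Sum>k<N. t ^ k) = 1 - t ^ N"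
    by (rule one_diff_power_eq[symmetric])
  have "r ^ (2 * (Suc (N + k) - N)) \<le> r ^ 2" for k
    using r by (intro power_decreasing) auto
  then have "(\<Sum>k<N. t ^ N * t ^ k / r\<^sup>2) \<le> (\<Sum>k<N. t ^ (N + k) / r ^ (2 * (Suc (N + k) - N)))"
    using t r by (intro sum_mono) (auto simp: power_add intro!: divide_left_mono)
  then have "(1 - t) * ((\<Sum>k<N. t ^ k) + t ^ N / r\<^sup>2 * (\<Sum>k<N. t ^ k)) \<le>
      (1 - t) * (\<Sum>k<N + N. t ^ k / r ^ (2 * (Suc k - N)))"
    using t unfolding sum_lessThan_add
    by (intro mult_left_mono add_mono) (auto simp: sum_distrib_left)
  moreover have "(1 - t) * ((\<Sum>k<N. t ^ k) + t ^ N / r\<^sup>2 * (\<Sum>k<N. t ^ k)) =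
      (1 - t ^ N) + t ^ N / r\<^sup>2 * (1 - t ^ N)"
    unfolding distrib_left mult.left_commute[of "1 - t" "t ^ N / r\<^sup>2"] geom ..
  moreover have "t ^ N / r\<^sup>2 * r\<^sup>2 < t ^ N / r\<^sup>2 * (1 - t ^ N)"
    using N t r by (intro mult_strict_left_mono) auto
  ultimately show ?thesis using r by simp
qed

text \<open>
  With \<open>f(z) = z\<^sup>N (1 - cnj a z) / (z - a)\<close>, the vector \<open>x = p(T) g\<close> below is, up to truncation, the
  image under \<open>f(T)\<^sup>*\<close> of the unit vector \<open>T\<^sup>N g\<close>; it satisfies \<open>\<parallel>f(T) x\<parallel> > \<parallel>x\<parallel>\<close> because the
  Laurent coefficients of \<open>f\<close> with negative index enter \<open>\<parallel>x\<parallel>\<close> with weights exceeding \<open>1\<close>.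
\<close>

lemma (in subspace_operator) not_spectral_set:
  assumes r: "0 < r" "r < 1"
    and orbit: "\<And>N. \<exists>g\<in>M. \<forall>i j. cinner ((T ^^ i) g) ((T ^^ j) g) =
      (if i = j then of_real (r ^ (2 * (i - N))) else 0)"
    and X: "X \<subseteq> cball 0 1" and a: "a \<noteq> 0" "cmod a < 1" and \<epsilon>: "\<epsilon> > 0"
    and dist: "\<And>z. z \<in> X \<Longrightarrow> \<epsilon> \<le> cmod (z - a)"
  shows "\<not> spectral_set X M T"
proof
  assume spec: "spectral_set X M T"
  define t where "t = (cmod a)\<^sup>2"
  have t: "0 < t" "t < 1" using a by (auto simp: t_def power_less_one_iff)
  have "(\<lambda>N. t ^ N) \<longlonglongrightarrow> 0" using t by (intro LIMSEQ_power_zero) auto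
  then have "\<forall>\<^sub>F N in sequentially. t ^ N < 1 - r\<^sup>2"
    using r by (intro order_tendstoD) (auto simp: power_less_one_iff)
  moreover have "\<forall>\<^sub>F N in sequentially. 1 / \<epsilon>\<^sup>2 \<le> real N"
    using filterlim_real_sequentially by (auto simp: filterlim_at_top)
  ultimately have "\<exists>N. t ^ N < 1 - r\<^sup>2 \<and> 1 / \<epsilon>\<^sup>2 \<le> real N"
    by (intro eventually_happens'[OF sequentially_bot] eventually_conj)
  then obtain N where N: "t ^ N < 1 - r\<^sup>2" "1 \<le> real N * \<epsilon>\<^sup>2"
    using \<epsilon> by (auto simp: field_simps)
  obtain g where gM: "g \<in> M" and g: "\<And>i j. cinner ((T ^^ i) g) ((T ^^ j) g) =
      (if i = j then of_real (r ^ (2 * (i - N))) else 0)"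
    using orbit by blast
  have norm_orbit: "(norm (poly_op p T g))\<^sup>2 = (\<Sum>i\<le>n. (cmod (coeff p i))\<^sup>2 * r ^ (2 * (i - N)))"
    if "degree p \<le> n" for p n
  proof -
    have "complex_of_real ((norm (poly_op p T g))\<^sup>2) =
        (\<Sum>i\<le>n. \<Sum>j\<le>n. if i = j then coeff p i * cnj (coeff p i) * of_real (r ^ (2 * (i - N))) else 0)"
      unfolding cinner_self[symmetric] poly_op_eq_sum[OF that] cinner_sum_left
      by (auto simp: cinner_sum_right cinner_scaleC_left cinner_scaleC_right g mult.assoc
          mult_delta_right
          simp del: of_real_power intro!: sum.cong)
    also have "\<dots> = complex_of_real (\<Sum>i\<le>n. (cmod (coeff p i))\<^sup>2 * r ^ (2 * (i - N)))"
      by (simp add: complex_norm_square[symmetric])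
    finally show ?thesis by (simp only: of_real_eq_iff)
  qed
  define L where "L = N + N"
  \<comment> \<open>For r = 1 and an infinite sum this would equal 1; the surplus comes from the
    terms with \<open>k \<ge> N\<close>, that is, from the negative Laurent indices.\<close>
  define s where "s = (1 - t) * (\<Sum>k<L. t ^ k / r ^ (2 * (Suc k - N)))"
  have s: "s > 1" unfolding s_def L_def by (rule weighted_geometric_sum_gt[OF t r N(1)])
  \<comment> \<open>\<open>c (Suc k)\<close> is the conjugate of the Laurent coefficient of f at
    index N - 1 - k, divided by the squared norm of \<open>(T ^^ Suc k) g\<close>, as the adjoint
    requires. The exact constant term would be -a; the factor \<open>s\<close> makes p(a) = 0, so
    that z - a can be divided out within polynomials.\<close>
  define c where "c i = (case i of 0 \<Rightarrow> - a * of_real s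
    | Suc k \<Rightarrow> of_real ((1 - t) / r ^ (2 * (Suc k - N))) * cnj a ^ k)" for i
  define p where "p = (\<Sum>i\<le>L. monom (c i) i)"
  have coeff_p: "coeff p i = (if i \<le> L then c i else 0)" for i
    by (simp add: p_def coeff_sum)
  have deg_p: "degree p \<le> L" by (rule degree_le) (simp add: coeff_p)
  have aa: "cnj a * a = of_real t"
    unfolding t_def complex_norm_square by (simp add: mult.commute)
  have "poly p a = - a * of_real s +
      (\<Sum>k<L. of_real ((1 - t) / r ^ (2 * (Suc k - N))) * cnj a ^ k * a ^ Suc k)"
    by (simp add: p_def poly_sum poly_monom c_def sum.atMost_shift)
  also have "(\<Sum>k<L. of_real ((1 - t) / r ^ (2 * (Suc k - N))) * cnj a ^ k * a ^ Suc k) =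
      a * (\<Sum>k<L. of_real ((1 - t) / r ^ (2 * (Suc k - N))) * (cnj a * a) ^ k)"
    by (simp add: sum_distrib_left power_mult_distrib mult_ac)
  also have "\<dots> = a * of_real s"
    by (simp add: aa s_def sum_distrib_left)
  finally have "poly p a = 0" by simp
  then obtain y where y: "p = [:- a, 1:] * y" by (metis dvdE poly_eq_0_iff_dvd)
  have "- a * coeff y 0 = coeff p 0" by (simp add: y)
  then have y0: "coeff y 0 = of_real s" using a by (simp add: coeff_p c_def)
  define b where "b = monom 1 N * [:1, - cnj a:]"
  have "norm (poly_op b T (poly_op y T g)) \<le> norm (poly_op [:- a, 1:] T (poly_op y T g))"
  proof (rule spectral_set_norm_le[OF spec])
    show "a \<notin> X" using dist[of a] \<epsilon> by auto
    fix z assume z: "z \<in> X"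
    have "poly b z = z ^ N * (1 - cnj a * z)"
      by (simp add: b_def poly_monom algebra_simps)
    then show "cmod (poly b z) \<le> cmod (z - a)"
      using Blaschke_power_le[of z a \<epsilon> N] z X a \<epsilon> dist N(2) by auto
  qed (intro poly_op_closed gM)
  then have "(norm (poly_op (b * y) T g))\<^sup>2 \<le> (norm (poly_op p T g))\<^sup>2"
    unfolding y using gM by (simp only: poly_op_mult) (simp add: power_mono)
  also have "\<dots> = t * s\<^sup>2 + (\<Sum>k<L. (cmod (c (Suc k)))\<^sup>2 * r ^ (2 * (Suc k - N)))"
    unfolding norm_orbit[OF deg_p]
    by (simp add: coeff_p sum.atMost_shift c_def norm_mult power_mult_distrib t_def)
  also have "(\<Sum>k<L. (cmod (c (Suc k)))\<^sup>2 * r ^ (2 * (Suc k - N))) = (1 - t) * s"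
    unfolding s_def sum_distrib_left
  proof (rule sum.cong[OF refl])
    fix k
    define \<rho> where "\<rho> = r ^ (2 * (Suc k - N))"
    have "\<rho> > 0" using r by (simp add: \<rho>_def)
    have "cmod (c (Suc k)) = \<bar>(1 - t) / \<rho>\<bar> * cmod a ^ k"
      by (simp only: c_def nat.case \<rho>_def norm_mult norm_of_real norm_power complex_mod_cnj)
    then have "(cmod (c (Suc k)))\<^sup>2 = ((1 - t) / \<rho>)\<^sup>2 * t ^ k"
      by (simp only: power_mult_distrib power2_abs t_def power_mult[symmetric] mult.commute[of k])
    then show "(cmod (c (Suc k)))\<^sup>2 * r ^ (2 * (Suc k - N)) =
        (1 - t) * ((1 - t) * (t ^ k / r ^ (2 * (Suc k - N))))"
      using \<open>\<rho> > 0\<close> unfolding \<rho>_def[symmetric] by (simp add: power2_eq_square field_simps)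
  qed
  finally have upper: "(norm (poly_op (b * y) T g))\<^sup>2 \<le> t * s\<^sup>2 + (1 - t) * s" .
  define n where "n = max N (degree (b * y))"
  have "coeff (b * y) N = coeff ([:1, - cnj a:] * y) 0"
    by (simp only: b_def mult.assoc coeff_monom_mult) simp
  also have "\<dots> = of_real s" by (simp add: y0)
  finally have "coeff (b * y) N = of_real s" .
  \<comment> \<open>The component along the unit vector \<open>(T ^^ N) g\<close> alone gives the
    lower bound s^2, which beats the upper bound t s^2 + (1 - t) s once s > 1.\<close>
  then have "s\<^sup>2 = (\<Sum>i\<in>{N}. (cmod (coeff (b * y) i))\<^sup>2 * r ^ (2 * (i - N)))"
    using s by simp
  also have "\<dots> \<le> (\<Sum>i\<le>n. (cmod (coeff (b * y) i))\<^sup>2 * r ^ (2 * (i - N)))"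
    using r by (intro sum_mono2) (auto simp: n_def)
  also have "\<dots> = (norm (poly_op (b * y) T g))\<^sup>2"
    by (rule norm_orbit[symmetric]) (simp add: n_def)
  finally have "(1 - t) * s\<^sup>2 \<le> (1 - t) * s" using upper by (simp add: algebra_simps)
  then have "s\<^sup>2 \<le> s" using t by simp
  then show False using s by (simp add: power2_eq_square)
qed

text \<open>The missing point may be 0 or lie on the circle, where the test function is useless.
  Moving it by at most \<open>h\<close> inside the ball that \<open>X\<close> misses avoids both and
  leaves the gap \<open>\<delta> - h\<close>.\<close>

lemma punctured_disk_point_off_compact:
  assumes "compact X" "X \<subset> cball (0::complex) 1"
  obtains a \<epsilon> where "a \<noteq> 0" "cmod a < 1" "\<epsilon> > 0" "\<And>z. z \<in> X \<Longrightarrow> \<epsilon> \<le> cmod (z - a)"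
proof -
  obtain z0 where z0: "z0 \<notin> X" "cmod z0 \<le> 1"
    using psubset_imp_ex_mem[OF assms(2)] by auto
  have "open (- X)" using assms(1) by (simp add: compact_imp_closed open_Compl)
  then obtain \<delta> where \<delta>: "\<delta> > 0" "ball z0 \<delta> \<subseteq> - X"
    using z0(1) open_contains_ball by (metis ComplI)
  define h where "h = min \<delta> 1 / 2"
  have h: "0 < h" "h < 1" "h < \<delta>" using \<delta>(1) by (auto simp: h_def)
  obtain a where a: "a \<noteq> 0" "cmod a < 1" "cmod (z0 - a) \<le> h"
  proof (cases "z0 = 0")
    case True
    then show ?thesis using that[of "of_real h"] h by simp
  next
    case False
    have "z0 - of_real (1 - h) * z0 = of_real h * z0" by (simp add: algebra_simps)
    then have "cmod (z0 - of_real (1 - h) * z0) \<le> h"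
      using z0(2) h by (simp add: norm_mult mult_left_le)
    moreover have "(1 - h) * cmod z0 \<le> 1 - h"
      using z0(2) h by (intro mult_left_le) auto
    then have "cmod (of_real (1 - h) * z0) < 1"
      using h by (simp only: norm_mult norm_of_real abs_of_pos)
    ultimately show ?thesis
      using that[of "of_real (1 - h) * z0"] False h by simp
  qed
  have "\<delta> - h \<le> cmod (z - a)" if "z \<in> X" for z
  proof -
    have "\<delta> \<le> cmod (z0 - z)" using \<delta>(2) that by (force simp: dist_norm not_less)
    then show ?thesis
      using norm_triangle_ineq[of "z0 - a" "a - z"] a(3) by (simp add: norm_minus_commute)
  qed
  then show ?thesis using that[OF a(1,2), of "\<delta> - h"] h by simp
qed

theorem theorem5p9:
  fixes r :: real
  assumes "0 < r" and "r < 1"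
    and infinite_dimensional_universe:
      "\<not> (\<exists>B. finite B \<and> span B = (UNIV :: 'a::complex_hilbert set))"
  shows "minimal_spectral_set (cball 0 1)
           (C_alpha r :: ('a::complex_hilbert set \<times> ('a \<Rightarrow> 'a)) set)"
  unfolding minimal_spectral_set_def
proof (intro conjI ballI allI impI)
  show "compact (cball (0::complex) 1)" by simp
next
  fix A :: "'a set \<times> ('a \<Rightarrow> 'a)" assume "A \<in> C_alpha r"
  then obtain M T where A: "A = (M, T)" "(M, T) \<in> C_alpha r" by (cases A) auto
  then interpret contraction_operator M T
    using C_alpha_contraction[OF A(2) assms(1,2)]
    by unfold_locales (auto simp: C_alpha_iff invertible_op_def)
  show "case A of (M, T) \<Rightarrow> spectral_set (cball 0 1) M T"
    using spectral_set_disk by (simp add: A)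
next
  fix X :: "complex set" assume X: "compact X \<and> X \<subset> cball 0 1"
  obtain M :: "'a set" and T where MT: "(M, T) \<in> C_alpha r"
    and orbit: "\<And>N. \<exists>g\<in>M. \<forall>i j. cinner ((T ^^ i) g) ((T ^^ j) g) =
      (if i = j then of_real (r ^ (2 * (i - N))) else 0)"
    using C_alpha_shift_exists[OF assms] by blast
  interpret subspace_operator M T
    using MT by unfold_locales (auto simp: C_alpha_iff invertible_op_def)
  obtain a \<epsilon> where "a \<noteq> 0" "cmod a < 1" "\<epsilon> > 0" "\<And>z. z \<in> X \<Longrightarrow> \<epsilon> \<le> cmod (z - a)"
    using punctured_disk_point_off_compact X by metis
  then have "\<not> spectral_set X M T"
    using X by (intro not_spectral_set[OF assms(1,2) orbit]) auto
  then show "\<exists>(M, T)\<in>C_alpha r. \<not> spectral_set X M (T :: 'a \<Rightarrow> 'a)"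
    using MT by blast
qed

end
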